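(* Let $N\geq 5$, let $V$ be an $N$-dimensional complex vector space equipped with a non-degenerate symmetric bilinear form $\eta_{ab}$, and let $\mathcal{W}_N$ be the complex vector space of Weyl-like tensors on $V$. Then the set of those $C\in\mathcal{W}_N$ for which there is no aligned null direction in $V$ is a dense, open subset of $\mathcal{W}_N$.
   Context: Indices are raised and lowered with $\eta_{ab}$. A Weyl-like tensor is a rank 4 covariant tensor $C_{abcd}$ on $V$ satisfying $C_{abcd}=-C_{bacd}=C_{cdab}$, $C_{abcd}+C_{acdb}+C_{adbc}=0$, and the trace condition $C_{abc}{}^{b}=0$. $\mathcal{W}_N$ is the finite-dimensional complex vector space of all such tensors, with its usual topology. A null vector is a vector $k$ with $k^ak_a=0$; a null direction is the span of a non-zero null vector. A null frame is a basis $\ell=m_0$, $n=m_1$, $m_2,\dots,m_{N-1}$ of $V$ with $\eta(\ell,n)=1$, $\eta(m_i,m_i)=1$ for $i=2,\dots,N-1$, and all other products zero. Components with respect to a null frame are $C_{ABCD}=C(m_A,m_B,m_C,m_D)$. The boost weight of $C_{ABCD}$ is the number of its indices equal to $0$ minus the number equal to $1$; for Weyl-like tensors the maximal boost weight is $2$, the corresponding components being $C_{0i0j}$, $2\le i,j\le N-1$. A null direction $[k]$ is aligned with $C$ if the components of maximal boost weight vanish, i.e. $C_{0i0j}=0$ for all $2\le i,j\le N-1$, in a null frame with $\ell$ a scalar multiple of $k$ (this condition does not depend on the choice of such a frame). *)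

theory Defs
  imports "HOL-Analysis.Analysis"
begin

text \<open>
  The space \<open>V\<close> is the whole type \<open>'v\<close>, with scalar multiplication \<open>scale\<close>.  The library's
  \<open>dim\<close> is \<open>0\<close> on infinite-dimensional spaces, so \<open>0 < N\<close> together with \<open>dim UNIV = N\<close>
  makes \<open>V\<close> finite-dimensional.
\<close>

locale complex_metric_space = vector_space scale
  for scale :: "complex \<Rightarrow> 'v::ab_group_add \<Rightarrow> 'v" (infixr \<open>*\<^sub>C\<close> 75) +
  fixes eta :: "'v \<Rightarrow> 'v \<Rightarrow> complex"
    and N :: nat
  assumes N_pos: "0 < N"
    and dim_eq: "dim (UNIV :: 'v set) = N"
    and eta_linear: "Vector_Spaces.linear scale (*) (\<lambda>x. eta x y)"
    and eta_sym: "eta x y = eta y x"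
    and eta_nondegenerate: "(\<And>y. eta x y = 0) \<Longrightarrow> x = 0"
begin

definition multilinear4 :: "('v \<Rightarrow> 'v \<Rightarrow> 'v \<Rightarrow> 'v \<Rightarrow> complex) \<Rightarrow> bool"
  where "multilinear4 C \<longleftrightarrow>
    (\<forall>b c d. Vector_Spaces.linear scale (*) (\<lambda>x. C x b c d)) \<and>
    (\<forall>a c d. Vector_Spaces.linear scale (*) (\<lambda>x. C a x c d)) \<and>
    (\<forall>a b d. Vector_Spaces.linear scale (*) (\<lambda>x. C a b x d)) \<and>
    (\<forall>a b c. Vector_Spaces.linear scale (*) (\<lambda>x. C a b c x))"

text \<open>Index raising: the vector \<open>r\<^sup>a\<close> with \<open>\<eta>\<^sub>a\<^sub>b r\<^sup>a = \<phi>\<^sub>b\<close>; see \<open>raise_index\<close> below.\<close>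

definition raise :: "('v \<Rightarrow> complex) \<Rightarrow> 'v"
  where "raise \<phi> = (THE r. \<forall>x. eta r x = \<phi> x)"

text \<open>The value does not depend on the chosen basis; see \<open>endo_trace_eq\<close> below.\<close>

definition endo_trace :: "('v \<Rightarrow> 'v) \<Rightarrow> complex"
  where "endo_trace f =
    (let B = (SOME B. independent B \<and> span B = UNIV) in \<Sum>b\<in>B. representation B (f b) b)"

text \<open>The last condition is \<open>C\<^sub>a\<^sub>b\<^sub>c\<^sup>b = 0\<close>: for fixed \<open>a\<close> and \<open>c\<close>, the trace of the
  endomorphism \<open>C\<^sub>a\<^sub>b\<^sub>c\<^sup>d\<close>.\<close>

definition weyl_like :: "('v \<Rightarrow> 'v \<Rightarrow> 'v \<Rightarrow> 'v \<Rightarrow> complex) \<Rightarrow> bool"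
  where "weyl_like C \<longleftrightarrow>
    multilinear4 C \<and>
    (\<forall>a b c d. C a b c d = - C b a c d) \<and>
    (\<forall>a b c d. C a b c d = C c d a b) \<and>
    (\<forall>a b c d. C a b c d + C a c d b + C a d b c = 0) \<and>
    (\<forall>a c. endo_trace (\<lambda>b. raise (\<lambda>d. C a b c d)) = 0)"

text \<open>The usual topology of the finite-dimensional space of Weyl-like tensors, obtained as the
  topology of pointwise convergence.  It agrees with the topology given by the components with
  respect to any basis of \<open>V\<close>; see \<open>openin_weyl_topology_iff\<close> below.\<close>

definition weyl_topology :: "('v \<Rightarrow> 'v \<Rightarrow> 'v \<Rightarrow> 'v \<Rightarrow> complex) topology"
  where "weyl_topology = top_of_set (Collect weyl_like)"

definition null_direction :: "'v set \<Rightarrow> bool"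
  where "null_direction L \<longleftrightarrow> (\<exists>k. k \<noteq> 0 \<and> eta k k = 0 \<and> L = span {k})"

definition null_frame :: "(nat \<Rightarrow> 'v) \<Rightarrow> bool"
  where "null_frame m \<longleftrightarrow>
    inj_on m {..<N} \<and> independent (m ` {..<N}) \<and> span (m ` {..<N}) = UNIV \<and>
    (\<forall>i<N. \<forall>j<N. eta (m i) (m j) =
      (if (i = 0 \<and> j = 1) \<or> (i = 1 \<and> j = 0) \<or> (i = j \<and> 2 \<le> i) then 1 else 0))"

definition aligned :: "('v \<Rightarrow> 'v \<Rightarrow> 'v \<Rightarrow> 'v \<Rightarrow> complex) \<Rightarrow> 'v set \<Rightarrow> bool"
  where "aligned C L \<longleftrightarrow>
    (\<exists>m. null_frame m \<and> m 0 \<in> L \<and>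
      (\<forall>i\<in>{2..<N}. \<forall>j\<in>{2..<N}. C (m 0) (m i) (m 0) (m j) = 0))"

lemma finite_basis:
  assumes "independent B" "span B = UNIV" shows "finite B"
proof (rule ccontr)
  assume "infinite B"
  moreover have "dim UNIV = card B"
    by (rule dim_eq_card) (simp_all add: assms)
  ultimately show False using dim_eq N_pos by simp
qed

lemma finite_dim_basis:
  obtains B where "independent B" "span B = UNIV" "finite B"
proof -
  obtain B :: "'v set" where "independent B" "UNIV \<subseteq> span B"
    using maximal_independent_subset by blast
  then show ?thesis using that finite_basis by blast
qed

lemma expand_basis:
  assumes "independent B" "span B = UNIV"
  shows "(\<Sum>b\<in>B. representation B v b *\<^sub>C b) = v"
  using assms finite_basis[OF assms] by (intro sum_representation_eq) auto

lemma linear_expand: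
  assumes "independent B" "span B = UNIV" "Vector_Spaces.linear scale (*) \<phi>"
  shows "\<phi> v = (\<Sum>b\<in>B. representation B v b * \<phi> b)"
proof -
  interpret l: Vector_Spaces.linear scale "(*)" \<phi> by fact
  have "\<phi> v = \<phi> (\<Sum>b\<in>B. representation B v b *\<^sub>C b)"
    by (simp add: expand_basis assms)
  then show ?thesis by (simp add: l.sum l.scale)
qed

lemma raise_index:
  assumes \<phi>: "Vector_Spaces.linear scale (*) \<phi>"
  shows "eta (raise \<phi>) x = \<phi> x"
proof -
  obtain B where B: "independent B" "span B = UNIV" "finite B"
    using finite_dim_basis by metis
  interpret fd: finite_dimensional_vector_space scale B
    by unfold_locales (use B in auto)
  have eta_linear2: "Vector_Spaces.linear scale (*) (eta x)" for x
  proof -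
    have "eta x = (\<lambda>y. eta y x)" by (intro ext eta_sym)
    then show ?thesis using eta_linear[of x] by metis
  qed
  define T where "T v = (\<Sum>b\<in>B. eta v b *\<^sub>C b)" for v
  have lin: "Vector_Spaces.linear scale scale T"
  proof (unfold_locales)
    fix u v c
    interpret l: Vector_Spaces.linear scale "(*)" "\<lambda>x. eta x b" for b by (rule eta_linear)
    show "T (u + v) = T u + T v"
      by (simp add: T_def l.add scale_left_distrib sum.distrib)
    show "T (c *\<^sub>C v) = c *\<^sub>C T v"
      by (simp add: T_def l.scale scale_sum_right)
  qed
  have coef: "f b = g b" if "(\<Sum>b\<in>B. f b *\<^sub>C b) = (\<Sum>b\<in>B. g b *\<^sub>C b)" "b \<in> B" for f g b
  proof -
    have "(\<Sum>b\<in>B. (f b - g b) *\<^sub>C b) = 0"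
      using that by (simp add: scale_left_diff_distrib sum_subtractf)
    then show ?thesis
      using B(1,3) that(2) independentD[of B B "\<lambda>b. f b - g b" b] by simp
  qed
  interpret l: Vector_Spaces.linear scale scale T by (rule lin)
  have eta_eq: "eta v x = \<psi> x"
    if \<psi>: "Vector_Spaces.linear scale (*) \<psi>" and Tv: "T v = (\<Sum>b\<in>B. \<psi> b *\<^sub>C b)" for v x \<psi>
  proof -
    have "eta v b = \<psi> b" if "b \<in> B" for b
      using coef[of "eta v" \<psi> b] that Tv by (simp add: T_def)
    then show ?thesis
      by (simp add: linear_expand[OF B(1,2) eta_linear2, of v x]
          linear_expand[OF B(1,2) \<psi>, of x])
  qed
  have "inj T"
  proof (rule l.inj_iff_eq_0[THEN iffD2], intro allI impI)
    fix v assume "T v = 0"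
    have "eta v x = 0" for x
    proof -
      have "Vector_Spaces.linear scale (*) (\<lambda>x. 0::complex)"
        by unfold_locales (auto simp: algebra_simps)
      then show ?thesis
        using eta_eq[of "\<lambda>x. 0" v x] \<open>T v = 0\<close> by simp
    qed
    then show "v = 0" by (rule eta_nondegenerate)
  qed
  then have "surj T"
    using fd.linear_inj_imp_surj lin by blast
  then obtain r where r: "T r = (\<Sum>b\<in>B. \<phi> b *\<^sub>C b)"
    by (metis surjD)
  have 1: "\<forall>x. eta r x = \<phi> x"
    using eta_eq[OF \<phi> r] by blast
  moreover have "s = r" if "\<forall>x. eta s x = \<phi> x" for s
  proof -
    have "T s = T r" using that 1 by (simp add: T_def)
    then show ?thesis using \<open>inj T\<close> by (simp add: injD)
  qed
  ultimately have "\<forall>x. eta (raise \<phi>) x = \<phi> x"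
    unfolding raise_def by (rule theI)
  then show ?thesis ..
qed

lemma endo_trace_eq:
  assumes f: "Vector_Spaces.linear scale scale f" and B: "independent B" "span B = UNIV"
  shows "endo_trace f = (\<Sum>b\<in>B. representation B (f b) b)"
proof -
  define A where "A = (SOME B. independent B \<and> span B = UNIV)"
  have A: "independent A" "span A = UNIV"
    using someI[of "\<lambda>B. independent B \<and> span B = UNIV" B] B by (auto simp: A_def)
  interpret l: Vector_Spaces.linear scale scale f by (rule f)
  have rep: "representation D (\<Sum>x\<in>S. g x *\<^sub>C h x) b = (\<Sum>x\<in>S. g x * representation D (h x) b)"
    if "independent D" "span D = UNIV" for D S b and g :: "'v \<Rightarrow> complex" and h :: "'v \<Rightarrow> 'v"
    using that by (simp add: representation_sum representation_scale)
  have "endo_trace f = (\<Sum>a\<in>A. representation A (f a) a)"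
    by (simp add: endo_trace_def A_def Let_def)
  also have "\<dots> = (\<Sum>a\<in>A. representation A (f (\<Sum>b\<in>B. representation B a b *\<^sub>C b)) a)"
    by (simp add: expand_basis B)
  also have "\<dots> = (\<Sum>a\<in>A. \<Sum>b\<in>B. representation B a b * representation A (f b) a)"
    by (simp add: l.sum l.scale rep[OF A])
  also have "\<dots> = (\<Sum>b\<in>B. \<Sum>a\<in>A. representation A (f b) a * representation B a b)"
    by (subst sum.swap) (simp add: mult.commute)
  also have "\<dots> = (\<Sum>b\<in>B. representation B (\<Sum>a\<in>A. representation A (f b) a *\<^sub>C a) b)"
    by (simp add: rep[OF B])
  also have "\<dots> = (\<Sum>b\<in>B. representation B (f b) b)"
    by (simp add: expand_basis A)
  finally show ?thesis .
qed

lemma multilinear4_expand: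
  assumes C: "multilinear4 C" and B: "independent B" "span B = UNIV"
  shows "C u v w z = (\<Sum>a\<in>B. \<Sum>b\<in>B. \<Sum>c\<in>B. \<Sum>d\<in>B.
    representation B u a * (representation B v b * (representation B w c *
      (representation B z d * C a b c d))))"
proof -
  have 1: "C u v w z = (\<Sum>a\<in>B. representation B u a * C a v w z)" for u v w z
    by (rule linear_expand[OF B]) (use C in \<open>auto simp: multilinear4_def\<close>)
  have 2: "C u v w z = (\<Sum>a\<in>B. representation B v a * C u a w z)" for u v w z
    by (rule linear_expand[OF B]) (use C in \<open>auto simp: multilinear4_def\<close>)
  have 3: "C u v w z = (\<Sum>a\<in>B. representation B w a * C u v a z)" for u v w z
    by (rule linear_expand[OF B]) (use C in \<open>auto simp: multilinear4_def\<close>)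
  have 4: "C u v w z = (\<Sum>a\<in>B. representation B z a * C u v w a)" for u v w z
    by (rule linear_expand[OF B]) (use C in \<open>auto simp: multilinear4_def\<close>)
  show ?thesis
    by (subst 1, subst 2, subst 3, subst 4) (simp add: sum_distrib_left)
qed

lemma openin_weyl_topology_iff:
  assumes B: "independent B" "span B = UNIV"
  shows "openin weyl_topology U \<longleftrightarrow>
    U \<subseteq> Collect weyl_like \<and>
    (\<forall>C\<in>U. \<exists>e>0. \<forall>D. weyl_like D \<and>
      (\<forall>a\<in>B. \<forall>b\<in>B. \<forall>c\<in>B. \<forall>d\<in>B. norm (D a b c d - C a b c d) < e) \<longrightarrow> D \<in> U)"
    (is "?L \<longleftrightarrow> ?R")
proof
  have fin: "finite B" by (rule finite_basis[OF B])
  let ?P = "B \<times> B \<times> B \<times> B"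
  have finP: "finite ?P" using fin by simp
  define F :: "('v \<times> 'v \<times> 'v \<times> 'v \<Rightarrow> complex) \<Rightarrow> 'v \<Rightarrow> 'v \<Rightarrow> 'v \<Rightarrow> 'v \<Rightarrow> complex"
    where "F x = (\<lambda>u v w z. \<Sum>a\<in>B. \<Sum>b\<in>B. \<Sum>c\<in>B. \<Sum>d\<in>B.
      representation B u a * (representation B v b * (representation B w c *
      (representation B z d * x (a, b, c, d)))))" for x
  define X where "X C = (\<lambda>(a, b, c, d). if (a, b, c, d) \<in> ?P then C a b c d else 0)"
    for C :: "'v \<Rightarrow> 'v \<Rightarrow> 'v \<Rightarrow> 'v \<Rightarrow> complex"
  have FX: "F (X C) = C" if "weyl_like C" for C
  proof -
    have C: "multilinear4 C" using that by (simp add: weyl_like_def)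
    have "F (X C) u v w z = C u v w z" for u v w z
      unfolding multilinear4_expand[OF C B, of u v w z] F_def X_def
      by (intro sum.cong refl) simp
    then show ?thesis by (intro ext)
  qed
  have contF: "continuous_on UNIV F"
    unfolding F_def
    by (intro continuous_on_coordinatewise_then_product continuous_intros
        continuous_on_product_coordinates)
  show ?R if L: ?L
  proof (intro conjI ballI)
    obtain G where G: "open G" "U = Collect weyl_like \<inter> G"
      using L by (auto simp: weyl_topology_def openin_open)
    then show "U \<subseteq> Collect weyl_like" by blast
    fix C assume C: "C \<in> U"
    have "open (F -` G)" by (rule open_vimage[OF G(1) contF])
    then have "openin (product_topology (\<lambda>_. euclidean) UNIV) (F -` G)"
      by (simp only: open_fun_def)
    moreover have "X C \<in> F -` G"
    proof -
      have "weyl_like C" "C \<in> G" using C by (simp_all add: G(2))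
      then show ?thesis by (simp add: FX)
    qed
    ultimately have "\<exists>Y. X C \<in> Pi\<^sub>E UNIV Y \<and> (\<forall>i. openin euclidean (Y i)) \<and>
        finite {i. Y i \<noteq> topspace euclidean} \<and> Pi\<^sub>E UNIV Y \<subseteq> F -` G"
      by (rule product_topology_open_contains_basis)
    then obtain Y where
      Y: "X C \<in> Pi\<^sub>E UNIV Y" "\<forall>i. openin euclidean (Y i)" "Pi\<^sub>E UNIV Y \<subseteq> F -` G"
      by (elim exE conjE) (rule that)
    have "open (Y i)" for i using Y(2) by (simp only: open_openin)
    have "\<exists>e>0. ball (X C i) e \<subseteq> Y i" for i
    proof -
      have "X C i \<in> Y i" using Y(1) by (rule PiE_mem) simp
      then show ?thesis using \<open>open (Y i)\<close> open_contains_ball by blast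
    qed
    then obtain e where e: "\<And>i. e i > 0" "\<And>i. ball (X C i) (e i) \<subseteq> Y i" by metis
    define e0 where "e0 = Min (insert 1 (e ` ?P))"
    have "e0 > 0" unfolding e0_def using finP e(1) by (subst Min_gr_iff) auto
    have e0: "e0 \<le> e i" if "i \<in> ?P" for i
      unfolding e0_def using finP that by (intro Min_le) auto
    show "\<exists>e>0. \<forall>D. weyl_like D \<and>
      (\<forall>a\<in>B. \<forall>b\<in>B. \<forall>c\<in>B. \<forall>d\<in>B. norm (D a b c d - C a b c d) < e) \<longrightarrow> D \<in> U"
    proof (intro exI[of _ e0] conjI allI impI; (elim conjE)?)
      fix D assume D: "weyl_like D"
        "\<forall>a\<in>B. \<forall>b\<in>B. \<forall>c\<in>B. \<forall>d\<in>B. norm (D a b c d - C a b c d) < e0"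
      have "X D i \<in> Y i" for i
      proof (cases "i \<in> ?P")
        case True
        obtain a b c d where i: "i = (a, b, c, d)" by (cases i)
        have "norm (D a b c d - C a b c d) < e i"
          using D(2) True e0[OF True] i by force
        then have "X D i \<in> ball (X C i) (e i)"
          using True i by (auto simp: X_def dist_norm norm_minus_commute)
        then show ?thesis using e(2) by blast
      next
        case False
        then have "X D i = X C i" by (auto simp: X_def split: prod.splits)
        then show ?thesis using Y(1) by auto
      qed
      then have "X D \<in> Pi\<^sub>E UNIV Y" by blast
      then have "F (X D) \<in> G" using Y(3) by blast
      then show "D \<in> U" unfolding G(2) using FX[OF D(1)] D(1) by simp
    qed fact
  qed
  show ?L if R: ?R
    unfolding weyl_topology_def
  proof (subst openin_subopen, intro ballI)
    fix C assume C: "C \<in> U"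
    from bspec[OF conjunct2[OF R] C] obtain e where e: "e > 0" "\<forall>D. weyl_like D \<and>
      (\<forall>a\<in>B. \<forall>b\<in>B. \<forall>c\<in>B. \<forall>d\<in>B. norm (D a b c d - C a b c d) < e) \<longrightarrow> D \<in> U"
      by (elim exE conjE) (rule that)
    define H where "H = (\<Inter>(a, b, c, d)\<in>?P. {D. norm (D a b c d - C a b c d) < e})"
    have "open {D :: 'v \<Rightarrow> 'v \<Rightarrow> 'v \<Rightarrow> 'v \<Rightarrow> complex. norm (D a b c d - C a b c d) < e}" for a b c d
    proof (rule open_Collect_less)
      have "continuous_on UNIV (\<lambda>D :: 'v \<Rightarrow> 'v \<Rightarrow> 'v \<Rightarrow> 'v \<Rightarrow> complex. D a b c d)"
        by (rule continuous_on_product_then_coordinatewise,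
            rule continuous_on_product_then_coordinatewise,
            rule continuous_on_product_then_coordinatewise,
            rule continuous_on_product_coordinates)
      then show "continuous_on UNIV
          (\<lambda>D :: 'v \<Rightarrow> 'v \<Rightarrow> 'v \<Rightarrow> 'v \<Rightarrow> complex. norm (D a b c d - C a b c d))"
        by (intro continuous_intros)
    qed auto
    then have "open H" unfolding H_def using finP by (intro open_INT) auto
    then have "openin (top_of_set (Collect weyl_like)) (Collect weyl_like \<inter> H)"
      by (rule openin_open_Int)
    moreover have "C \<in> Collect weyl_like \<inter> H" using C conjunct1[OF R] e(1) by (auto simp: H_def)
    moreover have "Collect weyl_like \<inter> H \<subseteq> U"
    proof
      fix D assume "D \<in> Collect weyl_like \<inter> H"
      then show "D \<in> U" by (intro e(2)[rule_format]) (auto simp: H_def)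
    qed
    ultimately show "\<exists>T. openin (top_of_set (Collect weyl_like)) T \<and> C \<in> T \<and> T \<subseteq> U" by blast
  qed
qed

end

end

theory Submission
  imports Defs "Jordan_Normal_Form.Spectral_Radius" "HOL-Library.Multiset"
begin

text \<open>
  A null direction \<open>[k]\<close> is aligned with \<open>C\<close> iff \<open>C(k, x, k, y) = 0\<close> for all \<open>x\<close>, \<open>y\<close> orthogonal to
  \<open>k\<close>.  This condition is closed in \<open>(C, k)\<close>, and \<open>k\<close> can be taken from a compact set, so the
  tensors with an aligned null direction form a closed set.

  For density, perturb a given \<open>C\<close> to \<open>C + t D\<close>, where \<open>D\<close> is the trace-free part of \<open>W \<and> W\<close> for
  a form \<open>W\<close> with distinct eigenvalues \<open>w\<^sub>i\<close>.  In an orthonormal eigenbasis the alignment equations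
  of \<open>D\<close>, together with \<open>\<Sum> x\<^sub>i\<^sup>2 = 0\<close>, generate an ideal that contains every monomial of degree
  \<open>6 N + 1\<close> in the coordinates \<open>x\<^sub>i\<close> of \<open>k\<close>; here \<open>N \<ge> 5\<close> is used, as three indices must leave at
  least two others.  The equations are affine in the tensor, so writing out these ideal memberships
  for \<open>C + t D\<close> gives \<open>t v + A v = 0\<close> for the vector \<open>v\<close> of those monomials at an aligned \<open>k\<close>, with
  a matrix \<open>A\<close> that does not depend on \<open>k\<close> or \<open>t\<close>.  As \<open>v\<close> is non-zero, \<open>- t\<close> is an eigenvalue
  of \<open>A\<close>, so only finitely many \<open>t\<close> are bad.
\<close>

section \<open>Linear families of homogeneous equations\<close>

text \<open>A bijection of \<open>I\<close> with \<open>{0..<n}\<close> turns \<open>A\<close> into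
  a square matrix, and every such \<open>t\<close> lies in the finite spectrum of that
  matrix.\<close>

lemma finite_eigenvalues:
  fixes A :: "'i \<Rightarrow> 'i \<Rightarrow> 'a::field"
  assumes "finite I"
  shows "finite {t. \<exists>v. (\<exists>i\<in>I. v i \<noteq> 0) \<and> (\<forall>i\<in>I. (\<Sum>j\<in>I. A i j * v j) = t * v i)}"
    (is "finite ?E")
proof -
  define n where "n = card I"
  obtain f where f: "bij_betw f {0..<n} I"
    using ex_bij_betw_nat_finite[OF assms] by (auto simp: n_def)
  define M where "M = Matrix.mat n n (\<lambda>(i, j). A (f i) (f j))"
  have M: "M \<in> carrier_mat n n" by (simp add: M_def)
  have "?E \<subseteq> spectrum M"
  proof
    fix t assume "t \<in> ?E"
    then obtain v i where v: "\<forall>i\<in>I. (\<Sum>j\<in>I. A i j * v j) = t * v i" and i: "i \<in> I" "v i \<noteq> 0"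
      by auto
    define u where "u = Matrix.vec n (\<lambda>i. v (f i))"
    obtain i' where i': "i' < n" "f i' = i"
      using f i(1) by (auto simp: bij_betw_def)
    have "vec_index u i' \<noteq> 0" using i' i by (simp add: u_def)
    then have "u \<noteq> 0\<^sub>v n" using i'(1) by auto
    moreover have "M *\<^sub>v u = t \<cdot>\<^sub>v u"
    proof (rule eq_vecI)
      fix a assume "a < dim_vec (t \<cdot>\<^sub>v u)"
      then have a: "a < n" by (simp add: u_def)
      then have fa: "f a \<in> I" using f by (auto simp: bij_betw_def)
      have "vec_index (M *\<^sub>v u) a = (\<Sum>j = 0..<n. A (f a) (f j) * v (f j))"
        using a by (simp add: M_def u_def scalar_prod_def)
      also have "\<dots> = (\<Sum>j\<in>I. A (f a) j * v j)"
        by (rule sum.reindex_bij_betw[OF f])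
      finally show "vec_index (M *\<^sub>v u) a = vec_index (t \<cdot>\<^sub>v u) a"
        using v fa a by (simp add: u_def)
    qed (simp add: M_def u_def)
    ultimately have "eigenvector M u t"
      by (simp add: eigenvector_def M_def u_def)
    then show "t \<in> spectrum M" by (auto simp: spectrum_def eigenvalue_def)
  qed
  then show ?thesis using card_finite_spectrum(1)[OF M] by (rule finite_subset)
qed

text \<open>Monomials are encoded as words of indices, so one monomial can have several words. This
  is harmless, because \<open>forms\<close> only asks that some coefficients exist.\<close>

definition monomials :: "nat \<Rightarrow> nat \<Rightarrow> nat list set"
  where "monomials n d = {xs. set xs \<subseteq> {..<n} \<and> length xs = d}"

definition forms :: "nat \<Rightarrow> (nat \<Rightarrow> 'a \<Rightarrow> complex) \<Rightarrow> nat \<Rightarrow> ('a \<Rightarrow> complex) set"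
  where "forms n X d = {q. \<exists>a. \<forall>k. q k = (\<Sum>xs\<in>monomials n d. a xs * (\<Prod>i\<leftarrow>xs. X i k))}"

lemma finite_monomials: "finite (monomials n d)"
  unfolding monomials_def by (rule finite_lists_length_eq) simp

lemma forms_const: "(\<lambda>k. c) \<in> forms n X 0"
proof -
  have "monomials n 0 = {[]}" by (auto simp: monomials_def)
  then show ?thesis by (auto simp: forms_def)
qed

lemma forms_add:
  assumes "p \<in> forms n X d" "q \<in> forms n X d"
  shows "(\<lambda>k. p k + q k) \<in> forms n X d"
proof -
  obtain a b where "\<And>k. p k = (\<Sum>xs\<in>monomials n d. a xs * (\<Prod>i\<leftarrow>xs. X i k))"
    "\<And>k. q k = (\<Sum>xs\<in>monomials n d. b xs * (\<Prod>i\<leftarrow>xs. X i k))"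
    using assms unfolding forms_def by auto
  then have "p k + q k = (\<Sum>xs\<in>monomials n d. (a xs + b xs) * (\<Prod>i\<leftarrow>xs. X i k))" for k
    by (simp add: sum.distrib distrib_right)
  then show ?thesis unfolding forms_def by (intro CollectI exI allI)
qed

lemma forms_scale:
  assumes "p \<in> forms n X d"
  shows "(\<lambda>k. c * p k) \<in> forms n X d"
proof -
  obtain a where "\<And>k. p k = (\<Sum>xs\<in>monomials n d. a xs * (\<Prod>i\<leftarrow>xs. X i k))"
    using assms unfolding forms_def by auto
  then have "c * p k = (\<Sum>xs\<in>monomials n d. (c * a xs) * (\<Prod>i\<leftarrow>xs. X i k))" for k
    by (simp add: sum_distrib_left mult.assoc)
  then show ?thesis unfolding forms_def by (intro CollectI exI allI)
qed

lemma forms_zero: "(\<lambda>k. 0) \<in> forms n X d"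
  unfolding forms_def by (intro CollectI exI[of _ "\<lambda>_. 0"] allI) simp

lemma forms_sum:
  assumes "\<And>s. s \<in> S \<Longrightarrow> p s \<in> forms n X d"
  shows "(\<lambda>k. \<Sum>s\<in>S. p s k) \<in> forms n X d"
  using assms by (induction S rule: infinite_finite_induct) (simp_all add: forms_add forms_zero)

lemma forms_times:
  assumes "p \<in> forms n X d" "i < n"
  shows "(\<lambda>k. X i k * p k) \<in> forms n X (Suc d)"
proof -
  obtain a where a: "\<And>k. p k = (\<Sum>xs\<in>monomials n d. a xs * (\<Prod>i\<leftarrow>xs. X i k))"
    using assms unfolding forms_def by auto
  \<comment> \<open>Multiplication by \<open>X i\<close> moves the coefficient of each word to the
    word with \<open>i\<close> put in front; all other words get coefficient 0.\<close>
  define b where "b ys = (if hd ys = i then a (tl ys) else 0)" for ys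
  have "X i k * p k = (\<Sum>ys\<in>monomials n (Suc d). b ys * (\<Prod>i\<leftarrow>ys. X i k))" for k
  proof -
    have "(\<Sum>ys\<in>monomials n (Suc d). b ys * (\<Prod>i\<leftarrow>ys. X i k)) =
        (\<Sum>ys\<in>(#) i ` monomials n d. b ys * (\<Prod>i\<leftarrow>ys. X i k))"
    proof (rule sum.mono_neutral_right[OF finite_monomials])
      show "(#) i ` monomials n d \<subseteq> monomials n (Suc d)"
        using assms(2) by (auto simp: monomials_def)
      show "\<forall>ys\<in>monomials n (Suc d) - (#) i ` monomials n d. b ys * (\<Prod>i\<leftarrow>ys. X i k) = 0"
      proof
        fix ys assume ys: "ys \<in> monomials n (Suc d) - (#) i ` monomials n d"
        then obtain j xs where "ys = j # xs" "xs \<in> monomials n d"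
          by (cases ys) (auto simp: monomials_def)
        with ys show "b ys * (\<Prod>i\<leftarrow>ys. X i k) = 0" by (auto simp: b_def)
      qed
    qed
    also have "\<dots> = (\<Sum>xs\<in>monomials n d. b (i # xs) * (X i k * (\<Prod>i\<leftarrow>xs. X i k)))"
      by (subst sum.reindex) (auto simp: inj_on_def)
    finally show ?thesis by (simp add: a b_def sum_distrib_left mult_ac)
  qed
  then show ?thesis unfolding forms_def by (intro CollectI exI allI)
qed

text \<open>Here \<open>(t, k) \<in> Z\<close> stands for: \<open>k\<close> is a common zero of the equations at the parameter
  \<open>t\<close>, which depend affinely on \<open>t\<close>.  The certified functions of degree \<open>d\<close> form the degree \<open>d\<close>
  part of the ideal of the leading coefficients of the equations.\<close>

definition certified ::
    "nat \<Rightarrow> (nat \<Rightarrow> 'a \<Rightarrow> complex) \<Rightarrow> (complex \<times> 'a) set \<Rightarrow> nat \<Rightarrow> ('a \<Rightarrow> complex) \<Rightarrow> bool"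
  where "certified n X Z d p \<longleftrightarrow> (\<exists>q\<in>forms n X d. \<forall>(t, k)\<in>Z. t * p k + q k = 0)"

text \<open>Only values on \<open>Z\<close> enter \<open>certified\<close>, so relations valid at
  every point of \<open>Z\<close>, such as the nullity of \<open>k\<close>, may be used to rewrite a
  certified function.\<close>

lemma certified_cong:
  assumes "certified n X Z d p" "\<And>t k. (t, k) \<in> Z \<Longrightarrow> p k = p' k"
  shows "certified n X Z d p'"
proof -
  obtain q where q: "q \<in> forms n X d" "\<forall>(t, k)\<in>Z. t * p k + q k = 0"
    using assms(1) unfolding certified_def by auto
  have "t * p' k + q k = 0" if "(t, k) \<in> Z" for t k
    using bspec[OF q(2) that] assms(2)[OF that] by simp
  then show ?thesis unfolding certified_def using q(1) by (intro bexI) auto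
qed

lemma certified_zero: "certified n X Z d (\<lambda>k. 0)"
  unfolding certified_def by (rule bexI[OF _ forms_zero]) auto

lemma certified_add:
  assumes "certified n X Z d p" "certified n X Z d p'"
  shows "certified n X Z d (\<lambda>k. p k + p' k)"
proof -
  obtain q q' where q: "q \<in> forms n X d" "\<forall>(t, k)\<in>Z. t * p k + q k = 0"
    and q': "q' \<in> forms n X d" "\<forall>(t, k)\<in>Z. t * p' k + q' k = 0"
    using assms unfolding certified_def by auto
  have "t * (p k + p' k) + (q k + q' k) = 0" if "(t, k) \<in> Z" for t k
  proof -
    have "(t * p k + q k) + (t * p' k + q' k) = 0"
      using bspec[OF q(2) that] bspec[OF q'(2) that] by simp
    then show ?thesis by (simp add: algebra_simps)
  qed
  then show ?thesis
    unfolding certified_def using forms_add[OF q(1) q'(1)] by (intro bexI) auto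
qed

lemma certified_scale:
  assumes "certified n X Z d p"
  shows "certified n X Z d (\<lambda>k. c * p k)"
proof -
  obtain q where q: "q \<in> forms n X d" "\<forall>(t, k)\<in>Z. t * p k + q k = 0"
    using assms unfolding certified_def by auto
  have "t * (c * p k) + c * q k = 0" if "(t, k) \<in> Z" for t k
  proof -
    have "c * (t * p k + q k) = 0" using q(2) that by auto
    then show ?thesis by (simp only: distrib_left mult.left_commute)
  qed
  then show ?thesis
    unfolding certified_def using forms_scale[OF q(1)] by (intro bexI) auto
qed

lemma certified_sum:
  assumes "\<And>s. s \<in> S \<Longrightarrow> certified n X Z d (p s)"
  shows "certified n X Z d (\<lambda>k. \<Sum>s\<in>S. p s k)"
  using assms
  by (induction S rule: infinite_finite_induct) (simp_all add: certified_add certified_zero)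

lemma certified_times:
  assumes "certified n X Z d p" "i < n"
  shows "certified n X Z (Suc d) (\<lambda>k. X i k * p k)"
proof -
  obtain q where q: "q \<in> forms n X d" "\<forall>(t, k)\<in>Z. t * p k + q k = 0"
    using assms unfolding certified_def by auto
  have "t * (X i k * p k) + X i k * q k = 0" if "(t, k) \<in> Z" for t k
  proof -
    have "X i k * (t * p k + q k) = 0" using q(2) that by auto
    then show ?thesis by (simp only: distrib_left mult.left_commute)
  qed
  then show ?thesis
    unfolding certified_def using forms_times[OF q(1) assms(2)] by (intro bexI) auto
qed

lemma certified_times_list:
  assumes "certified n X Z d p" "set xs \<subseteq> {..<n}"
  shows "certified n X Z (length xs + d) (\<lambda>k. (\<Prod>i\<leftarrow>xs. X i k) * p k)"
  using assms(2)
proof (induction xs)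
  case (Cons i xs)
  then show ?case
    using certified_times[of n X Z "length xs + d" "\<lambda>k. (\<Prod>i\<leftarrow>xs. X i k) * p k" i]
    by (simp add: mult.assoc)
qed (simp add: assms)

lemma finite_parameters:
  assumes cert: "\<And>xs. xs \<in> monomials n d \<Longrightarrow> certified n X Z d (\<lambda>k. \<Prod>i\<leftarrow>xs. X i k)"
    and nz: "\<And>t k. (t, k) \<in> Z \<Longrightarrow> \<exists>i<n. X i k \<noteq> 0"
  shows "finite (fst ` Z)"
proof -
  have "\<exists>a. \<forall>(t, k)\<in>Z.
      t * (\<Prod>i\<leftarrow>xs. X i k) + (\<Sum>ys\<in>monomials n d. a ys * (\<Prod>i\<leftarrow>ys. X i k)) = 0"
    if xs: "xs \<in> monomials n d" for xs
  proof -
    obtain q where q: "q \<in> forms n X d" "\<forall>(t, k)\<in>Z. t * (\<Prod>i\<leftarrow>xs. X i k) + q k = 0"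
      using cert[OF xs] unfolding certified_def by auto
    obtain a where "\<And>k. q k = (\<Sum>xs\<in>monomials n d. a xs * (\<Prod>i\<leftarrow>xs. X i k))"
      using q(1) unfolding forms_def by auto
    with q(2) show ?thesis by (intro exI[of _ a]) simp
  qed
  \<comment> \<open>The coefficients are chosen for each word before any \<open>(t, k)\<close>, so
    one matrix \<open>A\<close> serves all points of \<open>Z\<close>.\<close>
  then have "\<exists>A. \<forall>xs\<in>monomials n d. \<forall>(t, k)\<in>Z.
      t * (\<Prod>i\<leftarrow>xs. X i k) + (\<Sum>ys\<in>monomials n d. A xs ys * (\<Prod>i\<leftarrow>ys. X i k)) = 0"
    by (intro bchoice ballI)
  then obtain A where A: "\<And>xs t k. xs \<in> monomials n d \<Longrightarrow> (t, k) \<in> Z \<Longrightarrow>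
      t * (\<Prod>i\<leftarrow>xs. X i k) + (\<Sum>ys\<in>monomials n d. A xs ys * (\<Prod>i\<leftarrow>ys. X i k)) = 0"
    by blast
  define E where "E = {t. \<exists>v. (\<exists>i\<in>monomials n d. v i \<noteq> 0) \<and>
      (\<forall>i\<in>monomials n d. (\<Sum>j\<in>monomials n d. A i j * v j) = t * v i)}"
  have "finite E" unfolding E_def by (rule finite_eigenvalues[OF finite_monomials])
  moreover have "fst ` Z \<subseteq> uminus ` E"
  proof clarsimp
    fix t k assume tk: "(t, k) \<in> Z"
    obtain i where i: "i < n" "X i k \<noteq> 0" using nz[OF tk] by auto
    have "- t \<in> E" unfolding E_def
    proof (intro CollectI exI[of _ "\<lambda>xs. \<Prod>i\<leftarrow>xs. X i k"] conjI ballI)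
      \<comment> \<open>The word repeating \<open>i\<close> gives the entry
        \<open>X i k ^ d\<close>, so the vector of monomials is non-zero.\<close>
      show "\<exists>xs\<in>monomials n d. (\<Prod>i\<leftarrow>xs. X i k) \<noteq> 0"
        using i by (intro bexI[of _ "replicate d i"]) (auto simp: monomials_def)
      show "(\<Sum>ys\<in>monomials n d. A xs ys * (\<Prod>i\<leftarrow>ys. X i k)) = - t * (\<Prod>i\<leftarrow>xs. X i k)"
        if "xs \<in> monomials n d" for xs
        using A[OF that tk] by (simp add: add_eq_0_iff)
    qed
    then show "t \<in> uminus ` E" by (metis image_eqI minus_minus)
  qed
  ultimately show ?thesis by (meson finite_imageI finite_subset)
qed

section \<open>Elimination: from the alignment equations to all monomials of one degree\<close>

locale nondegenerate_certificate =
  fixes n :: nat and X :: "nat \<Rightarrow> 'a \<Rightarrow> complex" and Z :: "(complex \<times> 'a) set"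
    and w :: "nat \<Rightarrow> complex" and r :: complex
  assumes n: "n \<ge> 5" and inj: "inj_on w {..<n}" and r: "r \<noteq> 0"
    and null: "(t, k) \<in> Z \<Longrightarrow> (\<Sum>j<n. (X j k)\<^sup>2) = 0"
    and nonzero: "(t, k) \<in> Z \<Longrightarrow> \<exists>i<n. X i k \<noteq> 0"
    and quadruple: "\<lbrakk>a < n; b < n; e < n; d < n; distinct [a, b, e, d]\<rbrakk> \<Longrightarrow>
      certified n X Z 4 (\<lambda>k. X a k * X b k * X e k * X d k)"
    and relation: "\<lbrakk>a < n; b < n; d < n; distinct [a, b, d]\<rbrakk> \<Longrightarrow>
      certified n X Z 4 (\<lambda>k. X a k * X b k * ((\<Sum>j<n. (w d * w j + r * (w j)\<^sup>2) * (X j k)\<^sup>2)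
        - (w d - w a) * (w d - w b) * (X d k)\<^sup>2))"
begin

abbreviation I where "I \<equiv> certified n X Z"

definition U :: "nat \<Rightarrow> 'a \<Rightarrow> complex"
  where "U d k = (\<Sum>j<n. (w d * w j + r * (w j)\<^sup>2) * (X j k)\<^sup>2)"

text \<open>This is where \<open>n \<ge> 5\<close> enters: \<open>isolate\<close> needs two
  different indices outside the at most three that occur in a product.\<close>

lemma outside:
  assumes "finite S" "card S \<le> 3"
  obtains d d' where "d < n" "d' < n" "d \<noteq> d'" "d \<notin> S" "d' \<notin> S"
proof -
  have "2 \<le> card ({..<n} - S)"
    using n assms diff_card_le_card_Diff[of S "{..<n}"] by simp
  then obtain T where T: "T \<subseteq> {..<n} - S" "card T = 2"
    by (meson obtain_subset_with_card_n)
  then obtain d d' where "T = {d, d'}" "d \<noteq> d'" by (auto simp: card_2_iff)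
  with T show ?thesis using that by auto
qed

text \<open>With \<open>P\<close> and \<open>R\<close> the sums of \<open>w j\<close> and
  \<open>(w j)\<^sup>2\<close> times the squared coordinates, \<open>U d\<close> is
  \<open>w d * P + r * R\<close>. Two values of \<open>d\<close> separate \<open>P\<close> from
  \<open>R\<close>. Together with the vanishing sum of squares they span all sums whose coefficients
  are a quadratic polynomial in \<open>w j\<close>. A polynomial with roots \<alpha> and \<beta>
  removes the squares that \<open>rest\<close> does not cover, and only the one at \<open>a\<close>
  survives.\<close>

lemma isolate:
  assumes d: "d < n" "d' < n" "d \<noteq> d'"
    and U: "I m (\<lambda>k. p k * U d k)" "I m (\<lambda>k. p k * U d' k)"
    and a: "a < n" "w a \<noteq> \<alpha>" "w a \<noteq> \<beta>"
    and rest: "\<And>j. \<lbrakk>j < n; j \<noteq> a; w j \<noteq> \<alpha>; w j \<noteq> \<beta>\<rbrakk> \<Longrightarrow> I m (\<lambda>k. p k * (X j k)\<^sup>2)"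
  shows "I m (\<lambda>k. p k * (X a k)\<^sup>2)"
proof -
  let ?g = "\<lambda>j. (w j - \<alpha>) * (w j - \<beta>)"
  let ?\<delta> = "w d - w d'"
  have \<delta>: "?\<delta> \<noteq> 0" using d inj by (auto simp: inj_on_def)
  define P where "P k = (\<Sum>j<n. w j * (X j k)\<^sup>2)" for k
  define R where "R k = (\<Sum>j<n. (w j)\<^sup>2 * (X j k)\<^sup>2)" for k
  have U_eq: "U d k = w d * P k + r * R k" for d k
    by (simp add: U_def P_def R_def sum_distrib_left sum.distrib algebra_simps)
  \<comment> \<open>The term \<open>r * R\<close> does not depend on the index and cancels in the
    difference.\<close>
  have "I m (\<lambda>k. (1 / ?\<delta>) * (p k * U d k) + (- 1 / ?\<delta>) * (p k * U d' k))"
    by (intro certified_add certified_scale U)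
  then have P: "I m (\<lambda>k. p k * P k)"
  proof (rule certified_cong)
    fix t k
    have "p k * U d k - p k * U d' k = ?\<delta> * (p k * P k)" by (simp add: U_eq algebra_simps)
    then show "(1 / ?\<delta>) * (p k * U d k) + (- 1 / ?\<delta>) * (p k * U d' k) = p k * P k"
      using \<delta> by (simp add: eq_divide_eq mult.commute flip: diff_divide_distrib)
  qed
  have "I m (\<lambda>k. (1 / r) * (p k * U d k) + (- w d / r) * (p k * P k))"
    by (intro certified_add certified_scale U P)
  then have R: "I m (\<lambda>k. p k * R k)"
    by (rule certified_cong) (use r in \<open>simp add: U_eq field_simps\<close>)
  have "I m (\<lambda>k. p k * R k + (- (\<alpha> + \<beta>)) * (p k * P k))"
    by (intro certified_add certified_scale R P)
  then have G: "I m (\<lambda>k. p k * (\<Sum>j<n. ?g j * (X j k)\<^sup>2))"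
  proof (rule certified_cong)
    fix t k assume tk: "(t, k) \<in> Z"
    \<comment> \<open>The constant term \<alpha>\<beta> of the quadratic multiplies the sum of
      squares, which vanishes on \<open>Z\<close>.\<close>
    have "(\<Sum>j<n. ?g j * (X j k)\<^sup>2) = R k - (\<alpha> + \<beta>) * P k + \<alpha> * \<beta> * (\<Sum>j<n. (X j k)\<^sup>2)"
      unfolding R_def P_def sum_distrib_left sum_subtractf[symmetric] sum.distrib[symmetric]
      by (intro sum.cong refl) (simp add: power2_eq_square algebra_simps)
    then show "p k * R k + (- (\<alpha> + \<beta>)) * (p k * P k) = p k * (\<Sum>j<n. ?g j * (X j k)\<^sup>2)"
      using null[OF tk] by (simp only: mult_zero_right add_0_right) (simp add: right_diff_distrib distrib_left mult_ac)
  qed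
  have S: "I m (\<lambda>k. \<Sum>j\<in>{..<n} - {a}. ?g j * (p k * (X j k)\<^sup>2))"
  proof (rule certified_sum)
    fix j assume j: "j \<in> {..<n} - {a}"
    show "I m (\<lambda>k. ?g j * (p k * (X j k)\<^sup>2))"
    \<comment> \<open>The coefficient vanishes exactly when \<open>w j\<close> is \<alpha> or
      \<beta>; every other index is supplied by \<open>rest\<close>.\<close>
    proof (cases "?g j = 0")
      case True then show ?thesis by (simp only: mult_zero_left certified_zero)
    next
      case False
      then show ?thesis using j rest[of j] by (intro certified_scale) auto
    qed
  qed
  have "I m (\<lambda>k. (1 / ?g a) * (p k * (\<Sum>j<n. ?g j * (X j k)\<^sup>2) +
      (- 1) * (\<Sum>j\<in>{..<n} - {a}. ?g j * (p k * (X j k)\<^sup>2))))"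
    by (intro certified_add certified_scale G S)
  then show ?thesis
  proof (rule certified_cong)
    fix t k
    have "p k * (\<Sum>j<n. ?g j * (X j k)\<^sup>2) =
        p k * (?g a * (X a k)\<^sup>2) + (\<Sum>j\<in>{..<n} - {a}. ?g j * (p k * (X j k)\<^sup>2))"
      using a(1) by (subst sum.remove[of _ a]) (auto simp: distrib_left sum_distrib_left mult_ac)
    then show "(1 / ?g a) * (p k * (\<Sum>j<n. ?g j * (X j k)\<^sup>2) +
      (- 1) * (\<Sum>j\<in>{..<n} - {a}. ?g j * (p k * (X j k)\<^sup>2))) = p k * (X a k)\<^sup>2"
      using a(2,3) by simp
  qed
qed

text \<open>For \<open>d\<close> outside the triple, the product times the square of
  \<open>X d\<close> is \<open>X d\<close> times a certified quadruple. Hence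
  \<open>relation\<close>, multiplied by \<open>X e\<close>, certifies the product times
  \<open>U d\<close>, and \<open>isolate\<close> with roots \<open>w b\<close> and
  \<open>w e\<close> leaves the square of \<open>X a\<close>.\<close>

lemma triple:
  assumes "a < n" "b < n" "e < n" "distinct [a, b, e]"
  shows "I 5 (\<lambda>k. X a k * X b k * X e k * (X a k)\<^sup>2)"
proof -
  have sq: "I 5 (\<lambda>k. X a k * X b k * X e k * (X d k)\<^sup>2)" if d: "d < n" "d \<notin> {a, b, e}" for d
  proof (rule certified_cong)
    show "I 5 (\<lambda>k. X d k * (X a k * X b k * X e k * X d k))"
      using certified_times[OF quadruple[of a b e d], of d] d assms by simp
  qed (simp add: power2_eq_square)
  have u: "I 5 (\<lambda>k. X a k * X b k * X e k * U d k)" if d: "d < n" "d \<notin> {a, b, e}" for d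
  proof -
    have 1: "I 5 (\<lambda>k. X e k * (X a k * X b k * (U d k
        - (w d - w a) * (w d - w b) * (X d k)\<^sup>2)))"
      using certified_times[OF relation[of a b d], of e] d assms
      unfolding U_def by simp
    have "I 5 (\<lambda>k. X e k * (X a k * X b k * (U d k - (w d - w a) * (w d - w b) * (X d k)\<^sup>2)) +
        ((w d - w a) * (w d - w b)) * (X a k * X b k * X e k * (X d k)\<^sup>2))"
      by (intro certified_add certified_scale 1 sq d)
    then show ?thesis by (rule certified_cong) (simp add: algebra_simps)
  qed
  have "card {a, b, e} \<le> 3" by (simp add: card_insert_if)
  then obtain d d' where d: "d < n" "d' < n" "d \<noteq> d'" "d \<notin> {a, b, e}" "d' \<notin> {a, b, e}"
    using outside[of "{a, b, e}"] by auto
  show ?thesis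
  proof (rule isolate[where \<alpha> = "w b" and \<beta> = "w e", OF d(1-3) u[OF d(1,4)] u[OF d(2,5)]])
    show "w a \<noteq> w b" "w a \<noteq> w e" using assms inj by (auto simp: inj_on_eq_iff)
    show "I 5 (\<lambda>k. X a k * X b k * X e k * (X j k)\<^sup>2)" if "j < n" "j \<noteq> a" "w j \<noteq> w b" "w j \<noteq> w e" for j
      using that by (intro sq) auto
  qed fact
qed

text \<open>The argument of \<open>triple\<close> one level down: squares of outside coordinates
  come from \<open>triple\<close>, and \<open>relation\<close> is multiplied by \<open>X a\<close>
  twice. Only \<open>w b\<close> has to be removed, so it serves as both roots.\<close>

lemma pair:
  assumes "a < n" "b < n" "a \<noteq> b"
  shows "I 6 (\<lambda>k. X a k ^ 3 * X b k * (X a k)\<^sup>2)"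
proof -
  have sq: "I 6 (\<lambda>k. X a k ^ 3 * X b k * (X d k)\<^sup>2)" if d: "d < n" "d \<notin> {a, b}" for d
  proof (rule certified_cong)
    show "I 6 (\<lambda>k. X d k * (X a k * X b k * X d k * (X a k)\<^sup>2))"
      using certified_times[OF triple[of a b d], of d] d assms by simp
  qed (simp add: power2_eq_square power3_eq_cube)
  have u: "I 6 (\<lambda>k. X a k ^ 3 * X b k * U d k)" if d: "d < n" "d \<notin> {a, b}" for d
  proof -
    have 1: "I 6 (\<lambda>k. X a k * (X a k * (X a k * X b k * (U d k
        - (w d - w a) * (w d - w b) * (X d k)\<^sup>2))))"
      using certified_times[OF certified_times[OF relation[of a b d], of a], of a] d assms
      unfolding U_def by simp
    have "I 6 (\<lambda>k. X a k * (X a k * (X a k * X b k * (U d k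
          - (w d - w a) * (w d - w b) * (X d k)\<^sup>2))) +
        ((w d - w a) * (w d - w b)) * (X a k ^ 3 * X b k * (X d k)\<^sup>2))"
      by (intro certified_add certified_scale 1 sq d)
    then show ?thesis by (rule certified_cong) (simp add: algebra_simps power3_eq_cube)
  qed
  have "card {a, b} \<le> 3" by (simp add: card_insert_if)
  then obtain d d' where d: "d < n" "d' < n" "d \<noteq> d'" "d \<notin> {a, b}" "d' \<notin> {a, b}"
    using outside[of "{a, b}"] by auto
  show ?thesis
  proof (rule isolate[where \<alpha> = "w b" and \<beta> = "w b", OF d(1-3) u[OF d(1,4)] u[OF d(2,5)]])
    show "w a \<noteq> w b" "w a \<noteq> w b" using assms inj by (auto simp: inj_on_eq_iff)
    show "I 6 (\<lambda>k. X a k ^ 3 * X b k * (X j k)\<^sup>2)" if "j < n" "j \<noteq> a" "w j \<noteq> w b" "w j \<noteq> w b" for j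
      using that by (intro sq) auto
  qed fact
qed

text \<open>Nullity replaces one square of \<open>X a\<close> by minus the sum of the other squares.
  Each resulting term is \<open>X j\<close> times the certified function of \<open>pair\<close> for
  \<open>a\<close> and \<open>j\<close>.\<close>

lemma single:
  assumes "a < n"
  shows "I 7 (\<lambda>k. X a k ^ 7)"
proof -
  have "I 7 (\<lambda>k. (- 1) * (\<Sum>j\<in>{..<n} - {a}. X j k * (X a k ^ 3 * X j k * (X a k)\<^sup>2)))"
    using certified_times[OF pair[OF assms]] by (intro certified_scale certified_sum) auto
  then show ?thesis
  proof (rule certified_cong)
    fix t k assume "(t, k) \<in> Z"
    then have "(X a k)\<^sup>2 = - (\<Sum>j\<in>{..<n} - {a}. (X j k)\<^sup>2)"
      using null[of t k] assms by (subst (asm) sum.remove[of _ a]) (auto simp: eq_neg_iff_add_eq_0)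
    then have 1: "X a k ^ 5 * (X a k)\<^sup>2 = - (X a k ^ 5 * (\<Sum>j\<in>{..<n} - {a}. (X j k)\<^sup>2))"
      by simp
    have 2: "X a k ^ 5 * (X j k)\<^sup>2 = X j k * (X a k ^ 3 * X j k * (X a k)\<^sup>2)" for j
    proof -
      have "X a k ^ 5 = X a k ^ 3 * (X a k)\<^sup>2" by (simp flip: power_add)
      then show ?thesis by (simp add: power2_eq_square mult_ac)
    qed
    have "X a k ^ 7 = X a k ^ 5 * (X a k)\<^sup>2" by (simp flip: power_add)
    also have "\<dots> = (- 1) * (\<Sum>j\<in>{..<n} - {a}. X j k * (X a k ^ 3 * X j k * (X a k)\<^sup>2))"
      by (simp only: 1 sum_distrib_left[of "X a k ^ 5"] mult_minus1, simp only: 2)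
    finally show "(- 1) * (\<Sum>j\<in>{..<n} - {a}. X j k * (X a k ^ 3 * X j k * (X a k)\<^sup>2)) = X a k ^ 7"
      by (rule sym)
  qed
qed

text \<open>Pigeonhole: a word of length \<open>6 * n + 1\<close> over \<open>n\<close> letters
  repeats some letter at least seven times, so the monomial is a multiple of the power certified in
  \<open>single\<close>.\<close>

lemma monomial:
  assumes "xs \<in> monomials n (6 * n + 1)"
  shows "I (6 * n + 1) (\<lambda>k. \<Prod>i\<leftarrow>xs. X i k)"
proof -
  have xs: "set xs \<subseteq> {..<n}" "length xs = 6 * n + 1" using assms by (auto simp: monomials_def)
  have "\<exists>a<n. 7 \<le> count (mset xs) a"
  proof (rule ccontr)
    assume "\<not> ?thesis"
    then have le: "count (mset xs) a \<le> 6" if "a < n" for a using that by (force simp: not_le)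
    have "size (mset xs) = (\<Sum>a\<in>set xs. count (mset xs) a)" by (simp add: size_multiset_overloaded_eq)
    also have "\<dots> \<le> (\<Sum>a\<in>set xs. 6)" using le xs(1) by (intro sum_mono) auto
    also have "\<dots> \<le> 6 * n" using card_mono[OF _ xs(1)] by simp
    finally show False using xs(2) by simp
  qed
  then obtain a where a: "a < n" "7 \<le> count (mset xs) a" by auto
  then have sub: "replicate_mset 7 a \<subseteq># mset xs" by (simp add: count_le_replicate_mset_subset_eq)
  obtain ys where ys: "mset ys = mset xs - replicate_mset 7 a" using ex_mset by blast
  then have eq: "mset xs = mset ys + replicate_mset 7 a" using sub by simp
  have "set ys \<subseteq> {..<n}" using xs(1) arg_cong[OF eq, of set_mset] by auto
  moreover have "length ys + 7 = 6 * n + 1" using xs(2) arg_cong[OF eq, of size] by simp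
  ultimately have "I (6 * n + 1) (\<lambda>k. (\<Prod>i\<leftarrow>ys. X i k) * X a k ^ 7)"
    using certified_times_list[OF single[OF a(1)], of ys] by metis
  then show ?thesis
  proof (rule certified_cong)
    fix t k
    have "(\<Prod>i\<leftarrow>xs. X i k) = (\<Prod>i\<in>#mset xs. X i k)" by (simp flip: prod_mset_prod_list)
    also have "\<dots> = (\<Prod>i\<leftarrow>ys. X i k) * X a k ^ 7" by (simp add: eq flip: prod_mset_prod_list)
    finally show "(\<Prod>i\<leftarrow>ys. X i k) * X a k ^ 7 = (\<Prod>i\<leftarrow>xs. X i k)" by simp
  qed
qed

lemma finite_bad_parameters: "finite (fst ` Z)"
  using monomial nonzero by (rule finite_parameters)

end

section \<open>Orthonormal bases and null frames\<close>

context complex_metric_space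
begin

lemma eta_add_left: "eta (x + y) z = eta x z + eta y z"
proof -
  interpret l: Vector_Spaces.linear scale "(*)" "\<lambda>x. eta x z" by (rule eta_linear)
  show ?thesis by (rule l.add)
qed

lemma eta_scale_left: "eta (c *\<^sub>C x) z = c * eta x z"
proof -
  interpret l: Vector_Spaces.linear scale "(*)" "\<lambda>x. eta x z" by (rule eta_linear)
  show ?thesis by (rule l.scale)
qed

lemma eta_add_right: "eta z (x + y) = eta z x + eta z y"
  using eta_add_left[of x y z] by (simp add: eta_sym[of z])

lemma eta_scale_right: "eta z (c *\<^sub>C x) = c * eta z x"
  using eta_scale_left[of c x z] by (simp add: eta_sym[of z])

lemma eta_diff_left: "eta (x - y) z = eta x z - eta y z"
  using eta_add_left[of "x - y" y z] by simp

lemma eta_diff_right: "eta z (x - y) = eta z x - eta z y"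
  using eta_diff_left[of x y z] by (simp add: eta_sym[of z])

lemma eta_zero_left [simp]: "eta 0 z = 0"
  using eta_diff_left[of 0 0 z] by simp

lemma eta_zero_right [simp]: "eta z 0 = 0"
  using eta_diff_right[of z 0 0] by simp

lemma eta_sum_left: "eta (\<Sum>s\<in>S. f s) z = (\<Sum>s\<in>S. eta (f s) z)"
  by (induction S rule: infinite_finite_induct) (auto simp: eta_add_left)

lemma eta_sum_right: "eta z (\<Sum>s\<in>S. f s) = (\<Sum>s\<in>S. eta z (f s))"
  by (induction S rule: infinite_finite_induct) (auto simp: eta_add_right)

lemmas eta_bilinear = eta_add_left eta_add_right eta_scale_left eta_scale_right
  eta_diff_left eta_diff_right eta_sum_left eta_sum_right

text \<open>Pairing a vanishing linear combination with the dual vector of \<open>b\<close> reads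
  off the coefficient of \<open>b\<close>.\<close>

lemma independent_dual:
  assumes "\<And>b. b \<in> B \<Longrightarrow> \<exists>d. \<forall>a\<in>B. eta a d = (if a = b then 1 else 0)"
  shows "independent B"
  unfolding dependent_explicit
proof clarify
  fix S u v
  assume S: "finite S" "S \<subseteq> B" "(\<Sum>v\<in>S. u v *\<^sub>C v) = 0" "v \<in> S" "u v \<noteq> 0"
  obtain d where d: "\<forall>a\<in>B. eta a d = (if a = v then 1 else 0)"
    using assms[of v] S by auto
  have "0 = eta (\<Sum>v\<in>S. u v *\<^sub>C v) d" using S by simp
  also have "\<dots> = (\<Sum>b\<in>S. u b * (if b = v then 1 else 0))"
    using S(2) d by (auto simp: eta_bilinear intro!: sum.cong)
  also have "\<dots> = u v" using S by (simp add: if_distrib cong: if_cong)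
  finally show False using S by simp
qed

definition orthonormal :: "'v set \<Rightarrow> bool"
  where "orthonormal B \<longleftrightarrow> (\<forall>a\<in>B. \<forall>b\<in>B. eta a b = (if a = b then 1 else 0))"

lemma orthonormal_independent: "orthonormal B \<Longrightarrow> independent B"
  unfolding orthonormal_def by (intro independent_dual) blast

lemma independent_card_le: "independent B \<Longrightarrow> finite B \<and> card B \<le> N"
proof -
  obtain A where A: "independent A" "span A = UNIV" "finite A"
    using finite_dim_basis by metis
  interpret fd: finite_dimensional_vector_space scale A
    by unfold_locales (use A in auto)
  have "fd.dimension = N"
    using fd.dim_UNIV dim_eq by (simp add: fd.dimension_def)
  then show "independent B \<Longrightarrow> finite B \<and> card B \<le> N"
    using fd.independent_bound_general[of B] fd.dim_subset_UNIV[of B] by auto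
qed

text \<open>Take an orthonormal subset of \<open>W\<close> of greatest cardinality. If it did not
  span \<open>W\<close>, its orthogonal complement in \<open>W\<close> would contain a non-null
  vector, and normalising that vector would enlarge the set.\<close>

lemma orthonormal_basis:
  assumes W: "subspace W"
    and nondeg: "\<And>x. \<lbrakk>x \<in> W; \<And>y. y \<in> W \<Longrightarrow> eta x y = 0\<rbrakk> \<Longrightarrow> x = 0"
  obtains B where "orthonormal B" "finite B" "span B = W"
proof -
  define P where "P B \<longleftrightarrow> B \<subseteq> W \<and> orthonormal B" for B
  have "P {}" by (simp add: P_def orthonormal_def)
  moreover have card: "finite B \<and> card B \<le> N" if "P B" for B
    using that independent_card_le orthonormal_independent by (auto simp: P_def)
  ultimately have "\<exists>B. P B \<and> (\<forall>A. P A \<longrightarrow> card A \<le> card B)"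
    by (intro ex_has_greatest_nat[where b = "Suc N"]) (auto simp: less_Suc_eq_le)
  then obtain B where B: "P B" "\<And>A. P A \<Longrightarrow> card A \<le> card B" by auto
  have BW: "B \<subseteq> W" "finite B" and orth: "\<And>a b. a \<in> B \<Longrightarrow> b \<in> B \<Longrightarrow> eta a b = (if a = b then 1 else 0)"
    using B(1) card by (auto simp: P_def orthonormal_def)
  \<comment> \<open>This is the projection to the orthogonal complement of \<open>B\<close>.\<close>
  define \<pi> where "\<pi> v = v - (\<Sum>b\<in>B. eta v b *\<^sub>C b)" for v
  have \<pi>W: "\<pi> v \<in> W" if "v \<in> W" for v
    unfolding \<pi>_def using that BW by (intro subspace_diff subspace_sum subspace_scale W) auto
  have \<pi>B: "eta (\<pi> v) b = 0" if "b \<in> B" for v b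
  proof -
    have "(\<Sum>a\<in>B. eta v a * eta a b) = (\<Sum>a\<in>B. if a = b then eta v a else 0)"
      using that by (intro sum.cong) (auto simp: orth)
    then show ?thesis using that BW(2) by (simp add: \<pi>_def eta_bilinear)
  qed
  have "W \<subseteq> span B"
  proof (rule ccontr)
    assume "\<not> W \<subseteq> span B"
    then obtain w where w: "w \<in> W" "w \<notin> span B" by auto
    have "(\<Sum>b\<in>B. eta w b *\<^sub>C b) \<in> span B" by (intro span_sum span_scale span_base)
    then have "\<pi> w \<noteq> 0" using w(2) by (auto simp: \<pi>_def)
    then obtain y where y: "y \<in> W" "eta (\<pi> w) y \<noteq> 0" using nondeg[OF \<pi>W[OF w(1)]] by auto
    have "eta (\<pi> w) (\<pi> y) = eta (\<pi> w) y"
      unfolding \<pi>_def[of y] by (simp add: eta_bilinear \<pi>B)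
    with y have ne: "eta (\<pi> w) (\<pi> y) \<noteq> 0" by simp
    have "eta (\<pi> w + \<pi> y) (\<pi> w + \<pi> y) =
        eta (\<pi> w) (\<pi> w) + eta (\<pi> y) (\<pi> y) + 2 * eta (\<pi> w) (\<pi> y)"
      by (simp add: eta_add_left eta_add_right eta_sym[of "\<pi> y" "\<pi> w"])
    \<comment> \<open>Polarization: if all three vectors were null, the product of the first two
      would be zero.\<close>
    then have "\<exists>v\<in>{\<pi> w, \<pi> y, \<pi> w + \<pi> y}. eta v v \<noteq> 0" using ne by auto
    then obtain v where v: "v \<in> {\<pi> w, \<pi> y, \<pi> w + \<pi> y}" "eta v v \<noteq> 0" by blast
    have vW: "v \<in> W"
      using v(1) \<pi>W[OF w(1)] \<pi>W[OF y(1)] subspace_add[OF W] by auto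
    have vB: "eta v b = 0" if "b \<in> B" for b
      using v(1) \<pi>B[OF that] by (auto simp: eta_add_left)
    \<comment> \<open>Over the complex numbers every non-null vector can be scaled to have square
      1.\<close>
    define u where "u = (1 / csqrt (eta v v)) *\<^sub>C v"
    have "csqrt (eta v v) * csqrt (eta v v) = eta v v"
      using power2_csqrt[of "eta v v"] by (simp only: power2_eq_square)
    then have uu: "eta u u = 1" using v(2) by (simp add: u_def eta_bilinear)
    have uB: "eta u b = 0" "eta b u = 0" if "b \<in> B" for b
      using vB[OF that] eta_sym[of b v] by (auto simp: u_def eta_bilinear)
    have "u \<in> W" unfolding u_def using W vW by (rule subspace_scale)
    have "u \<notin> B" using uu uB by auto
    moreover from this have "P (insert u B)"
      using \<open>u \<in> W\<close> BW(1) uu uB orth by (auto simp: P_def orthonormal_def)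
    ultimately show False using B(2)[of "insert u B"] BW(2) by simp
  qed
  then have "span B = W" using span_minimal[OF BW(1) W] by auto
  then show ?thesis using that B(1) BW(2) by (auto simp: P_def)
qed

lemma orthonormal_frame:
  obtains e :: "nat \<Rightarrow> 'v" where
    "\<And>i j. \<lbrakk>i < N; j < N\<rbrakk> \<Longrightarrow> eta (e i) (e j) = (if i = j then 1 else 0)"
    "\<And>v. (\<Sum>i<N. eta v (e i) *\<^sub>C e i) = v"
    "independent (e ` {..<N})" "span (e ` {..<N}) = UNIV" "inj_on e {..<N}"
    "\<And>v i. i < N \<Longrightarrow> representation (e ` {..<N}) v (e i) = eta v (e i)"
proof -
  obtain B where B: "orthonormal B" "finite B" "span B = UNIV"
    using orthonormal_basis[of UNIV] eta_nondegenerate subspace_UNIV by (metis UNIV_I)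
  have ind: "independent B" using B(1) by (rule orthonormal_independent)
  have "card B = N" using dim_eq_card[of B UNIV] dim_eq ind B(3) by simp
  then obtain e where e: "bij_betw e {..<N} B"
    using ex_bij_betw_nat_finite[OF B(2)] by (auto simp: atLeast0LessThan)
  then have im: "e ` {..<N} = B" and inj: "inj_on e {..<N}" by (auto simp: bij_betw_def)
  have orth: "eta (e i) (e j) = (if i = j then 1 else 0)" if "i < N" "j < N" for i j
    using B(1) im inj that unfolding orthonormal_def by (auto simp: inj_on_eq_iff)
  have rep: "eta v b = representation B v b" if b: "b \<in> B" for v b
  proof -
    have "eta v b = eta (\<Sum>a\<in>B. representation B v a *\<^sub>C a) b"
      by (simp add: expand_basis ind B)
    also have "\<dots> = (\<Sum>a\<in>B. if a = b then representation B v a else 0)"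
      unfolding eta_sum_left eta_scale_left
      using B(1) b by (intro sum.cong) (auto simp: orthonormal_def)
    finally show ?thesis using b B(2) by simp
  qed
  have "(\<Sum>i<N. eta v (e i) *\<^sub>C e i) = v" for v
  proof -
    have "(\<Sum>i<N. eta v (e i) *\<^sub>C e i) = (\<Sum>b\<in>B. eta v b *\<^sub>C b)"
      by (rule sum.reindex_bij_betw[OF e])
    also have "\<dots> = v" using expand_basis[OF ind B(3), of v] by (simp add: rep)
    finally show ?thesis .
  qed
  moreover have "representation (e ` {..<N}) v (e i) = eta v (e i)" if "i < N" for v i
    using rep[of "e i" v] im that by auto
  ultimately show ?thesis using that[of e] orth im inj ind B(3) by simp
qed

text \<open>Complete \<open>k\<close> to a hyperbolic pair \<open>k\<close>, \<open>n\<close>. The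
  form is non-degenerate on the orthogonal complement \<open>W\<close> of this plane, and an
  orthonormal basis of \<open>W\<close> supplies the remaining frame vectors.\<close>

lemma null_frame_extending:
  assumes k: "k \<noteq> 0" "eta k k = 0"
  obtains m where "null_frame m" "m 0 = k"
proof -
  obtain y where "eta k y \<noteq> 0" using k(1) eta_nondegenerate by blast
  then obtain y' where y': "eta k y' = 1"
    by (metis eta_scale_right nonzero_eq_divide_eq)
  \<comment> \<open>Subtracting this multiple of \<open>k\<close> keeps the product with
    \<open>k\<close> equal to 1 and makes the vector null.\<close>
  define n where "n = y' - (eta y' y' / 2) *\<^sub>C k"
  have kn: "eta k n = 1" "eta n k = 1" and nn: "eta n n = 0"
    using k y' eta_sym[of y' k] by (auto simp: n_def eta_bilinear)
  define W where "W = {x. eta x k = 0 \<and> eta x n = 0}"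
  have W: "subspace W" by (auto simp: W_def subspace_def eta_bilinear)
  have decomp: "x - eta x n *\<^sub>C k - eta x k *\<^sub>C n \<in> W" for x
    using k kn nn by (simp add: W_def eta_bilinear)
  obtain B where B: "orthonormal B" "finite B" "span B = W"
  proof (rule orthonormal_basis[OF W])
    fix x assume x: "x \<in> W" "\<And>y. y \<in> W \<Longrightarrow> eta x y = 0"
    \<comment> \<open>Every \<open>y\<close> differs from an element of \<open>W\<close> by a
      combination of \<open>k\<close> and \<open>n\<close>, and \<open>x\<close> is orthogonal to
      both.\<close>
    have "eta x y = 0" for y
    proof -
      have "eta x (y - eta y n *\<^sub>C k - eta y k *\<^sub>C n) = 0" using x(2) decomp by blast
      then show ?thesis using x(1) by (simp add: W_def eta_bilinear)
    qed
    then show "x = 0" by (rule eta_nondegenerate)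
  qed
  have BW: "eta b k = 0" "eta b n = 0" "eta k b = 0" "eta n b = 0" if "b \<in> B" for b
    using span_base[OF that] B(3) eta_sym[of b] by (auto simp: W_def)
  obtain f where f: "bij_betw f {..<card B} B"
    using ex_bij_betw_nat_finite[OF B(2)] by (auto simp: atLeast0LessThan)
  define M where "M = card B + 2"
  define m where "m i = (if i = 0 then k else if i = 1 then n else f (i - 2))" for i
  have fB: "f i \<in> B" if "i < card B" for i using f that by (auto simp: bij_betw_def)
  have mB: "m i \<in> B" if "2 \<le> i" "i < M" for i
    using that fB[of "i - 2"] by (auto simp: m_def M_def)
  have gram: "eta (m i) (m j) =
      (if (i = 0 \<and> j = 1) \<or> (i = 1 \<and> j = 0) \<or> (i = j \<and> 2 \<le> i) then 1 else 0)"
    if ij: "i < M" "j < M" for i j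
  proof -
    have "eta (m i) (m j) = (if i = j then 1 else 0)" if "2 \<le> i" "2 \<le> j"
    proof -
      have "eta (m i) (m j) = (if m i = m j then 1 else 0)"
        using B(1) mB ij that by (auto simp: orthonormal_def)
      also have "m i = m j \<longleftrightarrow> i = j"
        using ij that f by (auto simp: m_def M_def bij_betw_def inj_on_eq_iff)
      finally show ?thesis .
    qed
    moreover have "i = 0 \<or> i = 1 \<or> 2 \<le> i" "j = 0 \<or> j = 1 \<or> 2 \<le> j" by auto
    ultimately show ?thesis
      using ij k(2) kn nn BW[OF mB[of i]] BW[OF mB[of j]]
      by (auto simp: m_def[of 0] m_def[of "Suc 0"])
  qed
  \<comment> \<open>Interchanging the indices 0 and 1 turns a null frame into its dual
    basis.\<close>
  define s where "s i = (if i = 0 then 1 else if i = 1 then 0 else i)" for i :: nat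
  have M: "2 \<le> M" by (simp add: M_def)
  have dual: "eta (m i) (m (s j)) = (if i = j then 1 else 0)" if "i < M" "j < M" for i j
    using that M by (subst gram) (auto simp: s_def)
  have inj: "inj_on m {..<M}"
    by (rule inj_onI) (metis dual lessThan_iff zero_neq_one)
  have ind: "independent (m ` {..<M})"
  proof (rule independent_dual)
    fix b assume "b \<in> m ` {..<M}"
    then obtain j where j: "j < M" "b = m j" by auto
    then show "\<exists>d. \<forall>a\<in>m ` {..<M}. eta a d = (if a = b then 1 else 0)"
      using dual inj by (intro exI[of _ "m (s j)"]) (auto simp: inj_on_eq_iff)
  qed
  have "B \<subseteq> m ` {..<M}"
  proof
    fix b assume "b \<in> B"
    then obtain i where "i < card B" "b = f i" using f by (auto simp: bij_betw_def)
    then show "b \<in> m ` {..<M}" by (intro image_eqI[of _ _ "i + 2"]) (auto simp: m_def M_def)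
  qed
  then have WS: "W \<subseteq> span (m ` {..<M})" using B(3) span_mono by blast
  have kS: "k \<in> span (m ` {..<M})" "n \<in> span (m ` {..<M})"
    using M by (auto intro!: span_base image_eqI[of _ m 0] image_eqI[of _ m 1] simp: m_def)
  have "x \<in> span (m ` {..<M})" for x
  proof -
    have "(x - eta x n *\<^sub>C k - eta x k *\<^sub>C n) + (eta x n *\<^sub>C k + eta x k *\<^sub>C n) \<in> span (m ` {..<M})"
      using WS decomp kS by (intro span_add span_scale) auto
    then show ?thesis by simp
  qed
  then have span: "span (m ` {..<M}) = UNIV" by auto
  \<comment> \<open>The length of the frame, so far two more than the size of \<open>B\<close>, is
    identified with the dimension only here.\<close>
  have "N = M"
    using dim_eq_card[of "m ` {..<M}" UNIV] dim_eq ind span card_image[OF inj] by simp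
  then have "null_frame m" unfolding null_frame_def using inj ind span gram by auto
  then show ?thesis using that by (simp add: m_def)
qed

section \<open>Multilinearity and a frame-free form of alignment\<close>

lemma multilinear4_add:
  assumes "multilinear4 C"
  shows "C (x + y) b c d = C x b c d + C y b c d" "C a (x + y) c d = C a x c d + C a y c d"
    "C a b (x + y) d = C a b x d + C a b y d" "C a b c (x + y) = C a b c x + C a b c y"
proof -
  have *: "\<phi> (x + y) = \<phi> x + \<phi> y" if "Vector_Spaces.linear scale (*) \<phi>" for \<phi> :: "'v \<Rightarrow> complex"
  proof -
    interpret l: Vector_Spaces.linear scale "(*)" \<phi> by fact
    show ?thesis by (rule l.add)
  qed
  show "C (x + y) b c d = C x b c d + C y b c d" "C a (x + y) c d = C a x c d + C a y c d"
    "C a b (x + y) d = C a b x d + C a b y d" "C a b c (x + y) = C a b c x + C a b c y"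
    using assms *[of "\<lambda>x. C x b c d"] *[of "\<lambda>x. C a x c d"] *[of "\<lambda>x. C a b x d"] *[of "C a b c"]
    unfolding multilinear4_def by blast+
qed

lemma multilinear4_scale:
  assumes "multilinear4 C"
  shows "C (r *\<^sub>C x) b c d = r * C x b c d" "C a (r *\<^sub>C x) c d = r * C a x c d"
    "C a b (r *\<^sub>C x) d = r * C a b x d" "C a b c (r *\<^sub>C x) = r * C a b c x"
proof -
  have *: "\<phi> (r *\<^sub>C x) = r * \<phi> x" if "Vector_Spaces.linear scale (*) \<phi>" for \<phi> :: "'v \<Rightarrow> complex"
  proof -
    interpret l: Vector_Spaces.linear scale "(*)" \<phi> by fact
    show ?thesis by (rule l.scale)
  qed
  show "C (r *\<^sub>C x) b c d = r * C x b c d" "C a (r *\<^sub>C x) c d = r * C a x c d"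
    "C a b (r *\<^sub>C x) d = r * C a b x d" "C a b c (r *\<^sub>C x) = r * C a b c x"
    using assms *[of "\<lambda>x. C x b c d"] *[of "\<lambda>x. C a x c d"] *[of "\<lambda>x. C a b x d"] *[of "C a b c"]
    unfolding multilinear4_def by blast+
qed

lemma multilinear4_diff:
  assumes "multilinear4 C"
  shows "C (x - y) b c d = C x b c d - C y b c d" "C a (x - y) c d = C a x c d - C a y c d"
    "C a b (x - y) d = C a b x d - C a b y d" "C a b c (x - y) = C a b c x - C a b c y"
  using multilinear4_add[OF assms, where x = "x - y" and y = y]
  by (simp_all add: eq_diff_eq)

lemma multilinear4_zero:
  assumes "multilinear4 C"
  shows "C 0 b c d = 0" "C a 0 c d = 0" "C a b 0 d = 0" "C a b c 0 = 0"
  using multilinear4_diff[OF assms, where x = 0 and y = 0] by simp_all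

lemma multilinear4_sum:
  assumes "multilinear4 C"
  shows "C (\<Sum>s\<in>S. f s) b c d = (\<Sum>s\<in>S. C (f s) b c d)"
    "C a (\<Sum>s\<in>S. f s) c d = (\<Sum>s\<in>S. C a (f s) c d)"
    "C a b (\<Sum>s\<in>S. f s) d = (\<Sum>s\<in>S. C a b (f s) d)"
    "C a b c (\<Sum>s\<in>S. f s) = (\<Sum>s\<in>S. C a b c (f s))"
  by (induction S rule: infinite_finite_induct,
      simp_all add: multilinear4_zero[OF assms] multilinear4_add[OF assms])

lemmas multilinear4_simps = multilinear4_add multilinear4_scale multilinear4_diff multilinear4_sum

definition aligned_vector :: "('v \<Rightarrow> 'v \<Rightarrow> 'v \<Rightarrow> 'v \<Rightarrow> complex) \<Rightarrow> 'v \<Rightarrow> bool"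
  where "aligned_vector C k \<longleftrightarrow> k \<noteq> 0 \<and> eta k k = 0 \<and>
    (\<forall>x y. eta k x = 0 \<longrightarrow> eta k y = 0 \<longrightarrow> C k x k y = 0)"

text \<open>In a null frame the hyperplane orthogonal to \<open>m 0\<close> is spanned by
  \<open>m 0\<close> and the \<open>m i\<close> with \<open>i \<ge> 2\<close>. Antisymmetry makes
  \<open>m 0\<close> contribute nothing in the second or fourth slot, so the frame condition already
  gives vanishing on the whole hyperplane. For the converse, \<open>k\<close> is extended to a null
  frame.\<close>

lemma ex_aligned_iff:
  assumes N: "2 \<le> N" and C: "weyl_like C"
  shows "(\<exists>L. null_direction L \<and> aligned C L) \<longleftrightarrow> (\<exists>k. aligned_vector C k)"
proof
  assume "\<exists>L. null_direction L \<and> aligned C L"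
  then obtain m where m: "null_frame m"
    and al: "\<And>i j. \<lbrakk>i \<in> {2..<N}; j \<in> {2..<N}\<rbrakk> \<Longrightarrow> C (m 0) (m i) (m 0) (m j) = 0"
    by (auto simp: aligned_def)
  have inj: "inj_on m {..<N}" and ind: "independent (m ` {..<N})" and span: "span (m ` {..<N}) = UNIV"
    and gram: "\<And>i j. \<lbrakk>i < N; j < N\<rbrakk> \<Longrightarrow> eta (m i) (m j) =
      (if (i = 0 \<and> j = 1) \<or> (i = 1 \<and> j = 0) \<or> (i = j \<and> 2 \<le> i) then 1 else 0)"
    using m by (auto simp: null_frame_def)
  have ml: "multilinear4 C" and anti: "\<And>a b c d. C a b c d = - C b a c d"
    and pair: "\<And>a b c d. C a b c d = C c d a b" using C unfolding weyl_like_def by blast+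
  have skew: "C a a c d = 0" "C c d a a = 0" for a c d
    using anti[of a a c d] pair[of c d a a] by auto
  have expand: "\<exists>f. x = (\<Sum>i<N. f i *\<^sub>C m i) \<and> f 1 = 0" if x: "eta (m 0) x = 0" for x
  proof -
    define f where "f i = representation (m ` {..<N}) x (m i)" for i
    have xf: "x = (\<Sum>i<N. f i *\<^sub>C m i)"
      using expand_basis[OF ind span, of x] by (simp add: sum.reindex[OF inj] f_def)
    \<comment> \<open>Among the frame vectors only \<open>m 1\<close> has a non-zero product with
      \<open>m 0\<close>, so this product is the coefficient \<open>f 1\<close>.\<close>
    have "0 = (\<Sum>i<N. f i * eta (m 0) (m i))"
      using x by (subst (asm) xf) (simp add: eta_bilinear)
    also have "\<dots> = (\<Sum>i<N. if i = 1 then f 1 else 0)"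
      using N by (intro sum.cong) (auto simp: gram)
    also have "\<dots> = f 1" using N by simp
    finally show ?thesis using xf by (intro exI[of _ f]) simp
  qed
  have "aligned_vector C (m 0)"
    unfolding aligned_vector_def
  proof (intro conjI allI impI)
    show "m 0 \<noteq> 0" using gram[of 0 1] N by auto
    show "eta (m 0) (m 0) = 0" using gram[of 0 0] N by simp
    fix x y assume "eta (m 0) x = 0" "eta (m 0) y = 0"
    then obtain f g where fg: "x = (\<Sum>i<N. f i *\<^sub>C m i)" "f 1 = 0"
      "y = (\<Sum>i<N. g i *\<^sub>C m i)" "g 1 = 0" using expand by meson
    have "C (m 0) x (m 0) y = (\<Sum>i<N. \<Sum>j<N. f i * (g j * C (m 0) (m i) (m 0) (m j)))"
      by (simp add: fg multilinear4_simps[OF ml] sum_distrib_left)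
        (subst sum.swap, simp add: mult.left_commute)
    also have "\<dots> = 0"
    proof (intro sum.neutral ballI)
      fix i j assume ij: "i \<in> {..<N}" "j \<in> {..<N}"
      consider "i = 0" | "i = 1" | "j = 0" | "j = 1" | "2 \<le> i" "2 \<le> j" by linarith
      then show "f i * (g j * C (m 0) (m i) (m 0) (m j)) = 0"
        using ij fg(2,4) by cases (auto simp: skew al)
    qed
    finally show "C (m 0) x (m 0) y = 0" .
  qed
  then show "\<exists>k. aligned_vector C k" by blast
next
  assume "\<exists>k. aligned_vector C k"
  then obtain k where k: "k \<noteq> 0" "eta k k = 0"
    and al: "\<And>x y. eta k x = 0 \<Longrightarrow> eta k y = 0 \<Longrightarrow> C k x k y = 0"
    by (auto simp: aligned_vector_def)
  obtain m where m: "null_frame m" "m 0 = k" using null_frame_extending[OF k] by blast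
  have "eta k (m i) = 0" if "i \<in> {2..<N}" for i
    using m that N by (auto simp: null_frame_def)
  then have "aligned C (span {k})"
    unfolding aligned_def using m al by (intro exI[of _ m]) (auto intro: span_base)
  then show "\<exists>L. null_direction L \<and> aligned C L"
    using k by (auto simp: null_direction_def)
qed

lemma weyl_like_multilinear: "weyl_like C \<Longrightarrow> multilinear4 C"
  unfolding weyl_like_def by (elim conjE)

lemma linearI:
  assumes "\<And>x y. f (x + y) = f x + f y" "\<And>r x. f (r *\<^sub>C x) = r * f x"
  shows "Vector_Spaces.linear scale (*) f"
  by unfold_locales (auto simp: assms algebra_simps)

lemma eta_eqI:
  assumes "\<And>y. eta x y = eta x' y"
  shows "x = x'"
  using eta_nondegenerate[of "x - x'"] assms by (simp add: eta_diff_left)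

lemma multilinear4_combination:
  assumes "multilinear4 C" "multilinear4 D"
  shows "multilinear4 (\<lambda>a b c d. C a b c d + t * D a b c d)"
  unfolding multilinear4_def
  by (intro conjI allI linearI)
    (simp_all add: multilinear4_simps[OF assms(1)] multilinear4_simps[OF assms(2)] algebra_simps)

lemma aligned_vector_scale:
  assumes "multilinear4 C" "aligned_vector C k" "r \<noteq> 0"
  shows "aligned_vector C (r *\<^sub>C k)"
  using assms by (auto simp: aligned_vector_def eta_bilinear multilinear4_simps[OF assms(1)])

text \<open>The arguments on the right are orthogonal to \<open>k\<close> automatically, and up to a
  non-zero factor every vector orthogonal to \<open>k\<close> has this form, by fixing one
  \<open>z\<close> with \<open>eta k z \<noteq> 0\<close>. Alignment thus becomes a family of
  polynomial equations without side conditions, as needed for closedness.\<close>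

lemma aligned_vector_iff:
  assumes C: "multilinear4 C" and k: "k \<noteq> 0"
  shows "aligned_vector C k \<longleftrightarrow> eta k k = 0 \<and>
    (\<forall>y z y' z'. C k (eta k z *\<^sub>C y - eta k y *\<^sub>C z) k (eta k z' *\<^sub>C y' - eta k y' *\<^sub>C z') = 0)"
proof
  assume R: "eta k k = 0 \<and> (\<forall>y z y' z'.
    C k (eta k z *\<^sub>C y - eta k y *\<^sub>C z) k (eta k z' *\<^sub>C y' - eta k y' *\<^sub>C z') = 0)"
  obtain z where z: "eta k z \<noteq> 0" using k eta_nondegenerate by blast
  have "C k x k y = 0" if "eta k x = 0" "eta k y = 0" for x y
    using R[THEN conjunct2, rule_format, of z x z y] that z by (simp add: multilinear4_simps[OF C])
  then show "aligned_vector C k" using R k by (simp add: aligned_vector_def)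
qed (auto simp: aligned_vector_def eta_bilinear mult.commute)

end

section \<open>A generic Weyl-like tensor\<close>

locale orthonormal_framed_space = complex_metric_space scale eta N
  for scale :: "complex \<Rightarrow> 'v::ab_group_add \<Rightarrow> 'v" (infixr \<open>*\<^sub>C\<close> 75) and eta N +
  fixes e :: "nat \<Rightarrow> 'v"
  assumes gram: "\<lbrakk>i < N; j < N\<rbrakk> \<Longrightarrow> eta (e i) (e j) = (if i = j then 1 else 0)"
    and expand: "(\<Sum>i<N. eta v (e i) *\<^sub>C e i) = v"
    and basis: "independent (e ` {..<N})" "span (e ` {..<N}) = UNIV" "inj_on e {..<N}"
    and rep: "i < N \<Longrightarrow> representation (e ` {..<N}) v (e i) = eta v (e i)"
begin

abbreviation X :: "nat \<Rightarrow> 'v \<Rightarrow> complex" where "X i k \<equiv> eta k (e i)"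

definition diag :: "(nat \<Rightarrow> complex) \<Rightarrow> 'v \<Rightarrow> 'v \<Rightarrow> complex"
  where "diag g u v = (\<Sum>i<N. g i * (X i u * X i v))"

lemma diag_sym: "diag g u v = diag g v u"
  by (simp add: diag_def mult.commute)

lemma diag_left: "diag g (x + y) z = diag g x z + diag g y z" "diag g (r *\<^sub>C x) z = r * diag g x z"
  "diag g (x - y) z = diag g x z - diag g y z"
  unfolding diag_def eta_bilinear sum_distrib_left sum.distrib[symmetric] sum_subtractf[symmetric]
  by (intro sum.cong refl; simp add: algebra_simps)+

lemma diag_right: "diag g z (x + y) = diag g z x + diag g z y" "diag g z (r *\<^sub>C x) = r * diag g z x"
  "diag g z (x - y) = diag g z x - diag g z y"
  unfolding diag_sym[of g z] by (rule diag_left)+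

lemmas diag_bilinear = diag_left diag_right

lemma diag_frame: "i < N \<Longrightarrow> diag g u (e i) = g i * X i u"
  "i < N \<Longrightarrow> diag g (e i) u = g i * X i u"
proof -
  assume i: "i < N"
  have "diag g u (e i) = (\<Sum>j<N. if j = i then g i * X i u else 0)"
    unfolding diag_def using i by (intro sum.cong) (auto simp: gram)
  then show "diag g u (e i) = g i * X i u" using i by simp
  then show "diag g (e i) u = g i * X i u" by (simp add: diag_sym[of g "e i"])
qed

lemma eta_diag: "eta u v = (\<Sum>i<N. X i u * X i v)"
proof -
  have "eta u v = eta u (\<Sum>i<N. X i v *\<^sub>C e i)" by (simp add: expand)
  then show ?thesis by (simp add: eta_bilinear mult.commute)
qed

text \<open>In an orthonormal frame the coordinates of a raised covector are its values on the
  frame, so the trace is the sum of the diagonal components.\<close>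

lemma contraction_eq:
  assumes C: "multilinear4 C"
  shows "endo_trace (\<lambda>b. raise (\<lambda>d. C a b c d)) = (\<Sum>i<N. C a (e i) c (e i))"
proof -
  let ?f = "\<lambda>b. raise (\<lambda>d. C a b c d)"
  have r: "eta (?f b) x = C a b c x" for b x
    using C by (intro raise_index) (simp add: multilinear4_def)
  have "Vector_Spaces.linear scale scale ?f"
  proof unfold_locales
    fix b b' and t :: complex
    show "?f (b + b') = ?f b + ?f b'" "?f (t *\<^sub>C b) = t *\<^sub>C ?f b"
      \<comment> \<open>Non-degeneracy reduces linearity of the raised map to linearity of
        \<open>C\<close> in its second slot.\<close>
      by (rule eta_eqI, simp only: r eta_bilinear, simp only: multilinear4_simps[OF C])+
  qed
  then have "endo_trace ?f = (\<Sum>b\<in>e ` {..<N}. representation (e ` {..<N}) (?f b) b)"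
    using basis by (intro endo_trace_eq) auto
  also have "\<dots> = (\<Sum>i<N. C a (e i) c (e i))"
    by (simp add: sum.reindex[OF basis(3)] rep r)
  finally show ?thesis .
qed

lemma weyl_like_iff:
  "weyl_like C \<longleftrightarrow> multilinear4 C \<and> (\<forall>a b c d. C a b c d = - C b a c d) \<and>
    (\<forall>a b c d. C a b c d = C c d a b) \<and> (\<forall>a b c d. C a b c d + C a c d b + C a d b c = 0) \<and>
    (\<forall>a c. (\<Sum>i<N. C a (e i) c (e i)) = 0)"
proof -
  have "(\<forall>a c. endo_trace (\<lambda>b. raise (\<lambda>d. C a b c d)) = 0) \<longleftrightarrow> (\<forall>a c. (\<Sum>i<N. C a (e i) c (e i)) = 0)"
    if "multilinear4 C" using contraction_eq[OF that] by simp
  then show ?thesis unfolding weyl_like_def by blast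
qed

lemma weyl_like_combination:
  assumes "weyl_like C" "weyl_like D"
  shows "weyl_like (\<lambda>a b c d. C a b c d + t * D a b c d)" (is "weyl_like ?E")
proof -
  have C: "\<And>a b c d. C a b c d = - C b a c d" "\<And>a b c d. C a b c d = C c d a b"
    "\<And>a b c d. C a b c d + C a c d b + C a d b c = 0" "\<And>a c. (\<Sum>i<N. C a (e i) c (e i)) = 0"
    using assms(1) unfolding weyl_like_iff by blast+
  have D: "\<And>a b c d. D a b c d = - D b a c d" "\<And>a b c d. D a b c d = D c d a b"
    "\<And>a b c d. D a b c d + D a c d b + D a d b c = 0" "\<And>a c. (\<Sum>i<N. D a (e i) c (e i)) = 0"
    using assms(2) unfolding weyl_like_iff by blast+
  show ?thesis
    unfolding weyl_like_iff
  proof (intro conjI allI)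
    show "multilinear4 ?E" using assms by (intro multilinear4_combination weyl_like_multilinear)
    fix a b c d
    show "?E a b c d = - ?E b a c d" using C(1)[of a b c d] D(1)[of a b c d] by simp
    show "?E a b c d = ?E c d a b" using C(2)[of a b c d] D(2)[of a b c d] by simp
    have "?E a b c d + ?E a c d b + ?E a d b c =
      (C a b c d + C a c d b + C a d b c) + t * (D a b c d + D a c d b + D a d b c)"
      by (simp add: algebra_simps)
    also have "\<dots> = 0" by (simp add: C(3) D(3))
    finally show "?E a b c d + ?E a c d b + ?E a d b c = 0" .
    show "(\<Sum>i<N. ?E a (e i) c (e i)) = 0"
      by (simp only: sum.distrib sum_distrib_left[symmetric] C(4) D(4)) simp
  qed
qed

text \<open>These are distinct values, shifted so that their sum is zero.\<close>

definition w :: "nat \<Rightarrow> complex"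
  where "w i = of_nat i - (of_nat N - 1) / 2"

text \<open>The contraction of \<open>generic\<close> vanishes when
  \<open>(of_nat N - 2) * s i + tau = (w i)\<^sup>2\<close>, where \<open>tau\<close> is the sum of
  the \<open>s i\<close>. Summing this over \<open>i\<close> forces the value given here.\<close>

definition tau :: complex
  where "tau = (\<Sum>i<N. (w i)\<^sup>2) / (2 * of_nat N - 2)"

definition s :: "nat \<Rightarrow> complex"
  where "s i = ((w i)\<^sup>2 - tau) / (of_nat N - 2)"

text \<open>The trace-free part of \<open>W\<^sub>a\<^sub>c W\<^sub>b\<^sub>d - W\<^sub>a\<^sub>d W\<^sub>b\<^sub>c\<close>, where \<open>W\<close> is a trace-free symmetric form with
  distinct eigenvalues \<open>w\<^sub>i\<close>.\<close>

definition generic :: "'v \<Rightarrow> 'v \<Rightarrow> 'v \<Rightarrow> 'v \<Rightarrow> complex"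
  where "generic a b c d = diag w a c * diag w b d - diag w a d * diag w b c
    + diag s a c * eta b d + diag s b d * eta a c - diag s a d * eta b c - diag s b c * eta a d"

lemma sum_w: "(\<Sum>i<N. w i) = 0"
proof -
  have "2 * (\<Sum>i<n. of_nat i :: complex) = of_nat n * (of_nat n - 1)" for n
    by (induction n) (auto simp: algebra_simps)
  from this[of N] have "(\<Sum>i<N. of_nat i :: complex) = of_nat N * ((of_nat N - 1) / 2)"
    by (simp add: mult.commute)
  then show ?thesis by (simp add: w_def sum_subtractf)
qed

lemma sum_s:
  assumes "3 \<le> N"
  shows "(\<Sum>i<N. s i) = tau"
proof -
  have N: "of_nat N - 2 \<noteq> (0::complex)" "2 * of_nat N - 2 \<noteq> (0::complex)"
    using assms of_nat_eq_iff[of N 2, where 'a = complex] of_nat_eq_iff[of N 1, where 'a = complex]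
    by auto
  have "(\<Sum>i<N. s i) = ((\<Sum>i<N. (w i)\<^sup>2) - of_nat N * tau) / (of_nat N - 2)"
    by (simp add: s_def sum_subtractf flip: sum_divide_distrib)
  also have "(\<Sum>i<N. (w i)\<^sup>2) = tau * (2 * of_nat N - 2)" using N(2) by (simp add: tau_def)
  also have "(tau * (2 * of_nat N - 2) - of_nat N * tau) / (of_nat N - 2) = tau"
    using N(1) by (simp add: divide_eq_eq algebra_simps)
  finally show ?thesis .
qed

text \<open>The index symmetries are those of a Kulkarni-Nomizu product of symmetric forms. The
  contraction is diagonal in the frame with entries
  \<open>(of_nat N - 2) * s i + tau - (w i)\<^sup>2\<close>, which are zero by the choice of
  \<open>s\<close>.\<close>

lemma generic_weyl_like:
  assumes N: "3 \<le> N"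
  shows "weyl_like generic"
  unfolding weyl_like_iff
proof (intro conjI allI)
  show "multilinear4 generic"
    unfolding multilinear4_def generic_def
    by (intro conjI allI linearI; simp only: diag_bilinear eta_bilinear; simp add: algebra_simps)
  fix a b c d
  show "generic a b c d = - generic b a c d" by (simp add: generic_def)
  show "generic a b c d = generic c d a b"
    unfolding generic_def
    by (simp add: diag_sym[of _ c] diag_sym[of _ d] eta_sym[of c] eta_sym[of d] mult.commute)
  show "generic a b c d + generic a c d b + generic a d b c = 0"
    unfolding generic_def diag_sym[of _ d b] diag_sym[of _ d c] diag_sym[of _ c b]
      eta_sym[of d b] eta_sym[of d c] eta_sym[of c b] by (simp add: algebra_simps)
  have N2: "of_nat N - 2 \<noteq> (0::complex)"
    using N of_nat_eq_iff[of N 2, where 'a = complex] by auto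
  have s: "(of_nat N - 2) * s i = (w i)\<^sup>2 - tau" for i
    using N2 by (simp add: s_def)
  have "(\<Sum>i<N. generic a (e i) c (e i)) = (\<Sum>i<N. diag w a c * w i - (w i)\<^sup>2 * (X i a * X i c)
      + diag s a c + s i * eta a c - 2 * s i * (X i a * X i c))"
  proof (intro sum.cong refl)
    fix i assume "i \<in> {..<N}"
    then show "generic a (e i) c (e i) = diag w a c * w i - (w i)\<^sup>2 * (X i a * X i c)
      + diag s a c + s i * eta a c - 2 * s i * (X i a * X i c)"
      by (simp add: generic_def diag_frame gram eta_sym[of "e i" c] power2_eq_square algebra_simps)
  qed
  also have "\<dots> = diag w a c * (\<Sum>i<N. w i) - (\<Sum>i<N. (w i)\<^sup>2 * (X i a * X i c))
      + of_nat N * diag s a c + (\<Sum>i<N. s i) * eta a c - (\<Sum>i<N. 2 * s i * (X i a * X i c))"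
    by (simp add: sum.distrib sum_subtractf sum_distrib_left sum_distrib_right)
  also have "\<dots> = (\<Sum>i<N. ((of_nat N - 2) * s i + tau - (w i)\<^sup>2) * (X i a * X i c))"
    unfolding sum_w sum_s[OF N] eta_diag[of a c] diag_def
    by (simp add: sum.distrib sum_subtractf sum_distrib_left algebra_simps)
  also have "\<dots> = 0" by (simp add: s)
  finally show "(\<Sum>i<N. generic a (e i) c (e i)) = 0" .
qed

text \<open>Of the four correction terms only the one with \<open>diag s k k\<close> survives the
  orthogonality assumptions, and its \<open>tau\<close> part is a multiple of
  \<open>eta k k\<close>.\<close>

lemma generic_null:
  assumes "eta k k = 0" "eta k x = 0" "eta k y = 0"
  shows "generic k x k y = diag w k k * diag w x y - diag w k x * diag w k y
    + 1 / (of_nat N - 2) * (\<Sum>i<N. (w i)\<^sup>2 * (X i k)\<^sup>2) * eta x y"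
proof -
  have "diag s k k = (\<Sum>i<N. ((w i)\<^sup>2 * (X i k)\<^sup>2 - tau * (X i k * X i k)) / (of_nat N - 2))"
    unfolding diag_def s_def by (intro sum.cong refl) (simp add: power2_eq_square left_diff_distrib)
  also have "\<dots> = ((\<Sum>i<N. (w i)\<^sup>2 * (X i k)\<^sup>2) - tau * eta k k) / (of_nat N - 2)"
    unfolding eta_diag[of k k] by (simp add: sum_subtractf sum_distrib_left flip: sum_divide_distrib)
  finally have "diag s k k = (\<Sum>i<N. (w i)\<^sup>2 * (X i k)\<^sup>2) / (of_nat N - 2)" using assms by simp
  then show ?thesis
    using assms by (simp add: generic_def eta_sym[of x k] diag_sym[of _ x k])
qed

section \<open>Alignment equations of a perturbed tensor, and density\<close>

definition bivec :: "nat \<Rightarrow> nat \<Rightarrow> 'v \<Rightarrow> 'v"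
  where "bivec a b k = X b k *\<^sub>C e a - X a k *\<^sub>C e b"

lemma bivec_orthogonal: "eta k (bivec a b k) = 0"
  by (simp add: bivec_def eta_bilinear)

definition bad :: "('v \<Rightarrow> 'v \<Rightarrow> 'v \<Rightarrow> 'v \<Rightarrow> complex) \<Rightarrow> (complex \<times> 'v) set"
  where "bad C = {(t, k). aligned_vector (\<lambda>a b c d. C a b c d + t * generic a b c d) k}"

lemma forms_tensor:
  assumes C: "multilinear4 C"
  shows "(\<lambda>k. C k y k z) \<in> forms N X 2"
proof -
  have "C k y k z = (\<Sum>i<N. \<Sum>j<N. X i k * (X j k * C (e i) y (e j) z))" for k
  proof -
    have "C k y k z = C (\<Sum>i<N. X i k *\<^sub>C e i) y (\<Sum>i<N. X i k *\<^sub>C e i) z" by (simp add: expand)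
    also have "\<dots> = (\<Sum>i<N. X i k * (\<Sum>j<N. X j k * C (e j) y (e i) z))"
      by (simp only: multilinear4_simps[OF C])
    also have "\<dots> = (\<Sum>i<N. \<Sum>j<N. X i k * (X j k * C (e i) y (e j) z))"
      unfolding sum_distrib_left by (subst sum.swap) (simp add: mult.left_commute)
    finally show ?thesis .
  qed
  moreover have "(\<lambda>k. \<Sum>i<N. \<Sum>j<N. X i k * (X j k * C (e i) y (e j) z)) \<in> forms N X 2"
  proof (intro forms_sum)
    fix i j assume "i \<in> {..<N}" "j \<in> {..<N}"
    then show "(\<lambda>k. X i k * (X j k * C (e i) y (e j) z)) \<in> forms N X 2"
      using forms_times[OF forms_times[OF forms_const]] by (simp add: numeral_2_eq_2)
  qed
  ultimately show ?thesis by simp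
qed

text \<open>The vectors \<open>bivec a b k\<close> are orthogonal to \<open>k\<close> and linear in
  \<open>k\<close>, so alignment of \<open>C + t * generic\<close> gives an equation affine in
  \<open>t\<close>. Its constant part is quartic: two degrees come from the slots filled by
  \<open>k\<close> and one from each bivector.\<close>

lemma certified_bivec:
  assumes C: "multilinear4 C" and abcd: "a < N" "b < N" "c < N" "d < N"
  shows "certified N X (bad C) 4 (\<lambda>k. generic k (bivec a b k) k (bivec c d k))"
proof -
  let ?q = "\<lambda>k. C k (bivec a b k) k (bivec c d k)"
  have "(\<lambda>k. X i k * (X j k * C k y k z)) \<in> forms N X 4" if "i < N" "j < N" for i j y z
    using forms_times[OF forms_times[OF forms_tensor[OF C] that(2)] that(1)]
    by (simp add: eval_nat_numeral)
  then have "(\<lambda>k. X b k * (X d k * C k (e a) k (e c)) + (- 1) * (X b k * (X c k * C k (e a) k (e d)))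
      + ((- 1) * (X a k * (X d k * C k (e b) k (e c))) + X a k * (X c k * C k (e b) k (e d))))
    \<in> forms N X 4"
    using abcd by (intro forms_add forms_scale) auto
  moreover have "X b k * (X d k * C k (e a) k (e c)) + (- 1) * (X b k * (X c k * C k (e a) k (e d)))
      + ((- 1) * (X a k * (X d k * C k (e b) k (e c))) + X a k * (X c k * C k (e b) k (e d))) = ?q k"
    for k
    by (simp add: bivec_def multilinear4_simps[OF C] algebra_simps)
  ultimately have "?q \<in> forms N X 4" by simp
  moreover have "t * generic k (bivec a b k) k (bivec c d k) + ?q k = 0" if "(t, k) \<in> bad C" for t k
    using that bivec_orthogonal by (simp add: bad_def aligned_vector_def add.commute)
  ultimately show ?thesis unfolding certified_def by (intro bexI) auto
qed

lemma nondegenerate_certificate: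
  assumes N: "5 \<le> N" and C: "multilinear4 C"
  shows "nondegenerate_certificate N X (bad C) w (1 / (of_nat N - 2))"
proof
  have null: "eta k k = 0" if "(t, k) \<in> bad C" for t k
    using that by (simp add: bad_def aligned_vector_def)
  have w_eq: "w a = w b \<longleftrightarrow> a = b" for a b by (simp add: w_def)
  show "5 \<le> N" by (rule N)
  show "inj_on w {..<N}" by (simp add: inj_on_def w_eq)
  show "1 / (of_nat N - 2) \<noteq> (0::complex)"
    using N of_nat_eq_iff[of N 2, where 'a = complex] by auto
  show "(\<Sum>j<N. (X j k)\<^sup>2) = 0" if "(t, k) \<in> bad C" for t k
    using null[OF that] unfolding eta_diag[of k k] by (simp add: power2_eq_square)
  show "\<exists>i<N. X i k \<noteq> 0" if "(t, k) \<in> bad C" for t k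
  proof (rule ccontr)
    assume "\<not> ?thesis"
    then have "k = 0" using expand[of k] by simp
    then show False using that by (simp add: bad_def aligned_vector_def)
  qed
  show "certified N X (bad C) 4 (\<lambda>k. X a k * X b k * X c k * X d k)"
    if abcd: "a < N" "b < N" "c < N" "d < N" "distinct [a, b, c, d]" for a b c d
  proof -
    let ?r = "(w a - w b) * (w c - w d)"
    have "certified N X (bad C) 4 (\<lambda>k. (- 1 / ?r) * generic k (bivec a b k) k (bivec c d k))"
      by (intro certified_scale certified_bivec C abcd)
    then show ?thesis
    proof (rule certified_cong)
      fix t k assume "(t, k) \<in> bad C"
      \<comment> \<open>For disjoint index pairs both \<open>eta\<close> and \<open>diag w\<close>
        vanish on the two bivectors, leaving only the product of their pairings with
        \<open>k\<close> under \<open>diag w\<close>.\<close>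
      then have "generic k (bivec a b k) k (bivec c d k) = - ?r * (X a k * X b k * X c k * X d k)"
        using abcd
        by (simp add: generic_null null bivec_orthogonal)
          (simp add: bivec_def diag_bilinear diag_frame eta_bilinear gram algebra_simps)
      then show "(- 1 / ?r) * generic k (bivec a b k) k (bivec c d k) = X a k * X b k * X c k * X d k"
        using abcd(5) by (simp add: w_eq)
    qed
  qed
  show "certified N X (bad C) 4 (\<lambda>k. X a k * X b k *
      ((\<Sum>j<N. (w d * w j + 1 / (of_nat N - 2) * (w j)\<^sup>2) * (X j k)\<^sup>2)
        - (w d - w a) * (w d - w b) * (X d k)\<^sup>2))"
    if abd: "a < N" "b < N" "d < N" "distinct [a, b, d]" for a b d
    \<comment> \<open>Here the bivectors share the index \<open>d\<close>, so their mutual products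
      do not vanish; these bring in the sum over all \<open>j\<close>.\<close>
    using certified_bivec[OF C abd(1,3,2,3)]
  proof (rule certified_cong)
    fix t k assume tk: "(t, k) \<in> bad C"
    have "(\<Sum>j<N. (w d * w j + 1 / (of_nat N - 2) * (w j)\<^sup>2) * (X j k)\<^sup>2) =
        w d * diag w k k + 1 / (of_nat N - 2) * (\<Sum>j<N. (w j)\<^sup>2 * (X j k)\<^sup>2)"
      by (simp add: diag_def sum_distrib_left sum.distrib power2_eq_square algebra_simps)
    moreover have "diag w (bivec a d k) (bivec b d k) = w d * X a k * X b k"
      "eta (bivec a d k) (bivec b d k) = X a k * X b k"
      "diag w k (bivec a d k) = (w a - w d) * X a k * X d k"
      "diag w k (bivec b d k) = (w b - w d) * X b k * X d k"
      using abd by (simp_all add: bivec_def diag_bilinear diag_frame eta_bilinear gram algebra_simps)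
    ultimately show "generic k (bivec a d k) k (bivec b d k) = X a k * X b k *
      ((\<Sum>j<N. (w d * w j + 1 / (of_nat N - 2) * (w j)\<^sup>2) * (X j k)\<^sup>2)
        - (w d - w a) * (w d - w b) * (X d k)\<^sup>2)"
      by (simp only: generic_null[OF null[OF tk] bivec_orthogonal bivec_orthogonal])
        (simp add: power2_eq_square algebra_simps)
  qed
qed

lemma finite_bad:
  assumes "5 \<le> N" "multilinear4 C"
  shows "finite (fst ` bad C)"
  using nondegenerate_certificate.finite_bad_parameters[OF nondegenerate_certificate[OF assms]] .

lemma dense_not_aligned:
  assumes N: "5 \<le> N" and C: "weyl_like C"
  shows "C \<in> weyl_topology closure_of {D. weyl_like D \<and> \<not> (\<exists>k. aligned_vector D k)}"
  unfolding in_closure_of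
proof (intro conjI allI impI)
  show "C \<in> topspace weyl_topology" using C by (simp add: weyl_topology_def)
  fix T assume T: "C \<in> T \<and> openin weyl_topology T"
  then obtain G where G: "open G" "T = Collect weyl_like \<inter> G"
    by (auto simp: weyl_topology_def openin_open)
  define \<phi> where "\<phi> t = (\<lambda>a b c d. C a b c d + t * generic a b c d)" for t
  have "continuous_on UNIV \<phi>"
    unfolding \<phi>_def by (intro continuous_on_coordinatewise_then_product continuous_intros)
  then have "open (\<phi> -` G)" by (rule open_vimage[OF G(1)])
  moreover have "0 \<in> \<phi> -` G" using T G by (simp add: \<phi>_def)
  \<comment> \<open>A non-empty open set of complex parameters is infinite, while only finitely many
    \<open>t\<close> are bad; any remaining \<open>t\<close> gives a nearby tensor without aligned
    vectors.\<close>
  ultimately have "infinite (\<phi> -` G)" using finite_imp_not_open by blast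
  moreover have "finite (fst ` bad C)"
    using N weyl_like_multilinear[OF C] by (rule finite_bad)
  ultimately obtain t where t: "t \<in> \<phi> -` G" "t \<notin> fst ` bad C"
    by (meson finite_subset subsetI)
  have "weyl_like (\<phi> t)"
    unfolding \<phi>_def using C generic_weyl_like N by (intro weyl_like_combination) auto
  moreover have "\<not> aligned_vector (\<phi> t) k" for k
    using t(2) by (force simp: bad_def \<phi>_def)
  ultimately show "\<exists>D. D \<in> {D. weyl_like D \<and> \<not> (\<exists>k. aligned_vector D k)} \<and> D \<in> T"
    using t(1) G(2) by (intro exI[of _ "\<phi> t"]) auto
qed

section \<open>Compactness of the normalized coordinates, and closedness\<close>

definition normalized :: "(nat \<Rightarrow> complex) set"
  where "normalized = (\<Pi>\<^sub>E i\<in>UNIV. cball 0 1) \<inter> (\<Union>i<N. {x. x i = 1})"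

definition vec_of :: "(nat \<Rightarrow> complex) \<Rightarrow> 'v"
  where "vec_of x = (\<Sum>i<N. x i *\<^sub>C e i)"

text \<open>Tychonoff gives compactness of the product of discs. This is why coordinates at indices
  \<open>\<ge> N\<close>, which \<open>vec_of\<close> ignores, are also confined to the
  disc.\<close>

lemma compact_normalized: "compact normalized"
proof -
  have "compactin (product_topology (\<lambda>_. euclidean) UNIV) (\<Pi>\<^sub>E i\<in>(UNIV::nat set). cball (0::complex) 1)"
    by (subst compactin_PiE) simp
  then have "compact (\<Pi>\<^sub>E i\<in>(UNIV::nat set). cball (0::complex) 1)"
    by (simp add: euclidean_product_topology)
  moreover have "closed (\<Union>i<N. {x :: nat \<Rightarrow> complex. x i = 1})"
    by (intro closed_UN ballI closed_Collect_eq continuous_intros continuous_on_product_coordinates) auto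
  ultimately show ?thesis unfolding normalized_def by (rule compact_Int_closed)
qed

lemma X_vec_of: "i < N \<Longrightarrow> X i (vec_of x) = x i"
proof -
  assume i: "i < N"
  have "X i (vec_of x) = (\<Sum>j<N. if j = i then x i else 0)"
    unfolding vec_of_def eta_sum_left eta_scale_left using i by (intro sum.cong) (auto simp: gram)
  then show ?thesis using i by simp
qed

lemma vec_of_nonzero: "x \<in> normalized \<Longrightarrow> vec_of x \<noteq> 0"
proof
  assume "x \<in> normalized" "vec_of x = 0"
  then obtain i where "i < N" "x i = 1" "X i (vec_of x) = 0" by (auto simp: normalized_def)
  then show False by (simp add: X_vec_of)
qed

text \<open>Alignment is invariant under scaling, so an aligned vector may be divided by a
  coordinate of greatest modulus.\<close>

lemma ex_aligned_vector_iff: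
  assumes C: "multilinear4 C"
  shows "(\<exists>k. aligned_vector C k) \<longleftrightarrow> (\<exists>x\<in>normalized. aligned_vector C (vec_of x))"
proof
  assume "\<exists>k. aligned_vector C k"
  then obtain k where k: "aligned_vector C k" by blast
  have "{..<N} \<noteq> {}" using N_pos by auto
  then have "Max ((\<lambda>i. norm (X i k)) ` {..<N}) \<in> (\<lambda>i. norm (X i k)) ` {..<N}"
    by (intro Max_in) auto
  then obtain i where "i < N" and max: "Max ((\<lambda>i. norm (X i k)) ` {..<N}) = norm (X i k)" by auto
  then have i: "i < N" "\<And>j. j < N \<Longrightarrow> norm (X j k) \<le> norm (X i k)"
    unfolding max[symmetric] by auto
  have "X i k \<noteq> 0"
  proof
    assume "X i k = 0"
    then have "k = 0" using expand[of k] i by simp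
    then show False using k by (simp add: aligned_vector_def)
  qed
  define x where "x j = (if j < N then X j k / X i k else 0)" for j
  have "x \<in> normalized"
    using i \<open>X i k \<noteq> 0\<close> by (auto simp: normalized_def x_def norm_divide divide_le_eq_1)
  moreover have "vec_of x = (1 / X i k) *\<^sub>C k"
    by (subst (4) expand[symmetric]) (simp add: vec_of_def x_def scale_sum_right)
  ultimately show "\<exists>x\<in>normalized. aligned_vector C (vec_of x)"
    using aligned_vector_scale[OF C k, of "1 / X i k"] \<open>X i k \<noteq> 0\<close> by (intro bexI[of _ x]) auto
qed blast

text \<open>The pairs of normalized coordinates and tensors satisfying the alignment equations form
  a closed set, and projection along a compact factor is a closed map.\<close>

lemma closedin_aligned:
  "closedin weyl_topology {C. weyl_like C \<and> (\<exists>k. aligned_vector C k)}"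
proof -
  \<comment> \<open>\<open>F\<close>, \<open>l\<close> and \<open>E\<close> spell out the equations
    of \<open>aligned_vector_iff\<close> in coordinates. They agree with them for multilinear
    \<open>C\<close>, but are visibly continuous for arbitrary functions \<open>C\<close>, so
    \<open>P\<close> is closed in the whole product space.\<close>
  define F where "F x C y z = (\<Sum>i<N. \<Sum>j<N. x i * (x j * C (e j) y (e i) z))"
    for x and C :: "'v \<Rightarrow> 'v \<Rightarrow> 'v \<Rightarrow> 'v \<Rightarrow> complex" and y z
  define l where "l x y = (\<Sum>i<N. x i * X i y)" for x y
  define E where "E = (\<lambda>(y, z, y', z') (x, C).
    l x z * l x z' * F x C y y' - l x z * l x y' * F x C y z'
    - l x y * l x z' * F x C z y' + l x y * l x y' * F x C z z')"
  define P where "P = {p. l (fst p) (vec_of (fst p)) = 0} \<inter> (\<Inter>q. {p. E q p = 0})"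
  have l_eq: "eta (vec_of x) y = l x y" for x y
    by (simp add: vec_of_def l_def eta_bilinear eta_sym[of "e _"])
  have F_eq: "C (vec_of x) y (vec_of x) z = F x C y z" if "multilinear4 C" for x C y z
    unfolding vec_of_def F_def by (simp only: multilinear4_simps[OF that] sum_distrib_left)
  have aligned: "aligned_vector C (vec_of x) \<longleftrightarrow> (x, C) \<in> P"
    if "x \<in> normalized" "weyl_like C" for x C
  proof -
    have C: "multilinear4 C" using that(2) by (rule weyl_like_multilinear)
    have "C (vec_of x) (l x z *\<^sub>C y - l x y *\<^sub>C z) (vec_of x) (l x z' *\<^sub>C y' - l x y' *\<^sub>C z') =
        E (y, z, y', z') (x, C)" for y z y' z'
      by (simp add: E_def F_eq[OF C, symmetric] multilinear4_simps[OF C] algebra_simps)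
    then show ?thesis
      using aligned_vector_iff[OF C vec_of_nonzero[OF that(1)]] by (simp add: P_def l_eq)
  qed
  have coord: "continuous_on UNIV
      (\<lambda>p :: (nat \<Rightarrow> complex) \<times> ('v \<Rightarrow> 'v \<Rightarrow> 'v \<Rightarrow> 'v \<Rightarrow> complex). fst p i)" for i
    by (rule continuous_on_product_then_coordinatewise) (intro continuous_intros)
  have comp: "continuous_on UNIV
      (\<lambda>p :: (nat \<Rightarrow> complex) \<times> ('v \<Rightarrow> 'v \<Rightarrow> 'v \<Rightarrow> 'v \<Rightarrow> complex). snd p a b c d)" for a b c d
    by (rule continuous_on_product_then_coordinatewise,
        rule continuous_on_product_then_coordinatewise,
        rule continuous_on_product_then_coordinatewise,
        rule continuous_on_product_then_coordinatewise) (intro continuous_intros)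
  have "closed P"
    unfolding P_def E_def F_def l_def vec_of_def eta_sum_left eta_scale_left split_def
    by (intro closed_Int closed_INT ballI closed_Collect_eq continuous_intros coord comp)
  define W where "W = Collect weyl_like"
  have "closedin (top_of_set (normalized \<times> W)) ((normalized \<times> W) \<inter> P)"
    using \<open>closed P\<close> by (rule closedin_closed_Int)
  then have "closedin (prod_topology (top_of_set normalized) weyl_topology) ((normalized \<times> W) \<inter> P)"
    by (simp add: weyl_topology_def W_def prod_topology_subtopology_eu)
  \<comment> \<open>Compactness of the first factor makes \<open>snd\<close> a closed map.\<close>
  moreover have "compact_space (top_of_set normalized)"
    using compact_normalized by (simp add: compact_space_subtopology)
  ultimately have "closedin weyl_topology (snd ` ((normalized \<times> W) \<inter> P))"
    using Abstract_Topological_Spaces.closed_map_snd unfolding closed_map_def by blast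
  also have "snd ` ((normalized \<times> W) \<inter> P) = {C. weyl_like C \<and> (\<exists>k. aligned_vector C k)}"
  proof -
    have "C \<in> snd ` ((normalized \<times> W) \<inter> P) \<longleftrightarrow> weyl_like C \<and> (\<exists>k. aligned_vector C k)" for C
    proof (cases "weyl_like C")
      case True
      then have "(\<exists>k. aligned_vector C k) \<longleftrightarrow> (\<exists>x\<in>normalized. (x, C) \<in> P)"
        using ex_aligned_vector_iff[OF weyl_like_multilinear[OF True]] aligned[OF _ True] by blast
      then show ?thesis using True by (force simp: W_def)
    qed (auto simp: W_def)
    then show ?thesis by blast
  qed
  finally show ?thesis .
qed

end

section \<open>Openness and density without a chosen frame\<close>

context complex_metric_space
begin

lemma open_dense_not_aligned:
  assumes N: "5 \<le> N"
  defines "G \<equiv> {C. weyl_like C \<and> \<not> (\<exists>L. null_direction L \<and> aligned C L)}"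
  shows "openin weyl_topology G \<and> weyl_topology closure_of G = Collect weyl_like"
proof -
  obtain e where e: "\<And>i j. \<lbrakk>i < N; j < N\<rbrakk> \<Longrightarrow> eta (e i) (e j) = (if i = j then 1 else 0)"
    "\<And>v. (\<Sum>i<N. eta v (e i) *\<^sub>C e i) = v"
    "independent (e ` {..<N})" "span (e ` {..<N}) = UNIV" "inj_on e {..<N}"
    "\<And>v i. i < N \<Longrightarrow> representation (e ` {..<N}) v (e i) = eta v (e i)"
    using orthonormal_frame by blast
  have "orthonormal_framed_space scale eta N e"
    by unfold_locales (use e in auto)
  then interpret orthonormal_framed_space scale eta N e .
  have G: "G = {C. weyl_like C \<and> \<not> (\<exists>k. aligned_vector C k)}"
    unfolding G_def using ex_aligned_iff N by auto
  have top: "topspace weyl_topology = Collect weyl_like" by (simp add: weyl_topology_def)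
  have "G = topspace weyl_topology - {C. weyl_like C \<and> (\<exists>k. aligned_vector C k)}"
    by (auto simp: G top)
  then have "openin weyl_topology G"
    using closedin_aligned by (simp add: openin_diff)
  moreover have "Collect weyl_like \<subseteq> weyl_topology closure_of G"
    unfolding G using dense_not_aligned[OF N] by blast
  moreover have "weyl_topology closure_of G \<subseteq> Collect weyl_like"
    using closure_of_subset_topspace[of weyl_topology G] top by simp
  ultimately show ?thesis by blast
qed

end

theorem theorem5p2:
  fixes scale :: "complex \<Rightarrow> 'v::ab_group_add \<Rightarrow> 'v"
    and eta :: "'v \<Rightarrow> 'v \<Rightarrow> complex"
    and N :: nat
  assumes "complex_metric_space scale eta N"
    and "N \<ge> 5"
  shows "openin (complex_metric_space.weyl_topology scale eta)
           {C. complex_metric_space.weyl_like scale eta C \<and>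
             \<not> (\<exists>L. complex_metric_space.null_direction scale eta L \<and>
                  complex_metric_space.aligned scale eta N C L)}
       \<and> complex_metric_space.weyl_topology scale eta closure_of
           {C. complex_metric_space.weyl_like scale eta C \<and>
             \<not> (\<exists>L. complex_metric_space.null_direction scale eta L \<and>
                  complex_metric_space.aligned scale eta N C L)}
         = {C. complex_metric_space.weyl_like scale eta C}"
  by (rule complex_metric_space.open_dense_not_aligned[OF assms])

end
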